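(* Let $\wp\psi$ be a behavioral GFG-QPTL sentence with $\psi$ an LTL formula and $\mathrm{ap}(\wp)$ containing all propositions of $\psi$. Then $\wp\psi$ is satisfiable iff Eloise wins the quantification game $\mathcal G_{\wp,L(\psi)}$, and $\wp\psi$ is unsatisfiable iff Abelard wins $\mathcal G_{\wp,L(\psi)}$, where $L(\psi)=\{\chi\in\mathrm{Asg}(\mathrm{ap}(\wp)):\chi\models_{LTL}\psi\}$.
   Context: Let $AP$ be a set of atomic propositions and $\mathbb B=\{\top,\bot\}$. A temporal valuation is a function $f:\mathbb N\to\mathbb B$. An assignment is a partial function $\chi:AP\rightharpoonup(\mathbb N\to\mathbb B)$; $\mathrm{Asg}$ is the set of all assignments, $\mathrm{Asg}(P)$ the set of assignments with domain exactly $P\subseteq AP$. For an assignment $\chi$, $p\in AP$ and a temporal valuation $f$, $\chi[p\mapsto f]$ is the assignment that agrees with $\chi$ except that it maps $p$ to $f$. A hyperassignment is a set $\mathcal X$ with $\emptyset\neq\mathcal X\subseteq 2^{\mathrm{Asg}(P)}$ and $\emptyset\notin\mathcal X$, for some $P\subseteq AP$; this $P$ is denoted $\mathrm{ap}(\mathcal X)$. $\mathrm{HAsg}$ is the set of all hyperassignments, $\mathrm{HAsg}(P)$ those with $\mathrm{ap}(\mathcal X)=P$, and $\mathrm{HAsg}_\supseteq(P)$ those with $\mathrm{ap}(\mathcal X)\supseteq P$. A choice function for $\mathcal X$ is a map $c:\mathcal X\to\mathrm{Asg}$ with $c(X)\in X$ for all $X\in\mathcal X$. The dual of $\mathcal X$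 is $\overline{\mathcal X}=\{\mathrm{img}(c): c\text{ a choice function for }\mathcal X\}$. $\mathrm{par}(\mathcal X)$ is the set of pairs $(\mathcal X_1,\mathcal X_2)$ of (possibly empty) subsets of $\mathcal X$ with $\mathcal X_1\cap\mathcal X_2=\emptyset$ and $\mathcal X_1\cup\mathcal X_2=\mathcal X$. A functor over $P\subseteq AP$ is a function $F:\mathrm{Asg}(P)\to(\mathbb N\to\mathbb B)$; $\mathrm{Fnc}(P)$ is the set of all of them. $\mathrm{ext}(\chi,F,p)=\chi[p\mapsto F(\chi)]$ and $\mathrm{ext}(X,F,p)=\{\mathrm{ext}(\chi,F,p):\chi\in X\}$. For $\chi_1,\chi_2\in\mathrm{Asg}(P)$, $p\in P$, $k\in\mathbb N$: $\chi_1\approx^{>k}_p\chi_2$ iff $\chi_1(q)=\chi_2(q)$ for all $q\in P\setminus\{p\}$ and $\chi_1(p)(t)=\chi_2(p)(t)$ for all $t\le k$; $\chi_1\approx^{\ge k}_p\chi_2$ is defined the same way with $t<k$ in place of $t\le k$. $F\in\mathrm{Fnc}(P)$ is behavioral (resp. strongly behavioral) w.r.t. $p\in P$ if $F(\chi_1)(k)=F(\chi_2)(k)$ for all $k\in\mathbb N$ and all $\chi_1,\chi_2$ with $\chi_1\approx^{>k}_p\chi_2$ (resp. $\chi_1\approx^{\ge k}_p\chi_2$). A quantifier specification is a pair $\sigma=\langle P_B,P_S\rangle$ of subsets of $AP$; $\mathrm{Fnc}_\sigma(P)$ is the set of $F\in\mathrm{Fnc}(P)$ that are behavioral w.r.t.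 every $p\in P_B\cap P$ and strongly behavioral w.r.t. every $p\in P_S\cap P$. $\mathrm{ext}_\sigma(\mathcal X,p)=\{\mathrm{ext}(X,F,p):X\in\mathcal X,\ F\in\mathrm{Fnc}_\sigma(\mathrm{ap}(\mathcal X))\}$. Write $\mathsf B=\langle AP,\emptyset\rangle$. GFG-QPTL formulas are generated by $\varphi::=\psi\mid\neg\varphi\mid\varphi\wedge\varphi\mid\varphi\vee\varphi\mid\exists p{:}\sigma.\varphi\mid\forall p{:}\sigma.\varphi$, where $\psi$ is an LTL formula over $AP$, $p\in AP$ and $\sigma$ a quantifier specification; we also write $\exists^\sigma p.\varphi$, $\forall^\sigma p.\varphi$. QPTL formulas are those in which every specification is $\langle\emptyset,\emptyset\rangle$. $\mathrm{free}(\varphi)$ is the set of free propositions. $\chi\models_{LTL}\psi$ iff the infinite word whose $t$-th letter is the valuation $q\mapsto\chi(q)(t)$ satisfies $\psi$ in the standard LTL sense. Alternation flags are $\exists\forall$ and $\forall\exists$; $\bar\alpha$ is the flag different from $\alpha$. For a GFG-QPTL formula $\varphi$, $\mathcal X\in\mathrm{HAsg}_\supseteq(\mathrm{free}(\varphi))$ and flag $\alpha$, $\mathcal X\models^\alpha\varphi$ is defined inductively: (1) for LTL $\psi$: $\mathcal X\models^{\exists\forall}\psi$ iff there is $X\in\mathcal X$ with $\chi\models_{LTL}\psi$ for all $\chi\in X$; $\mathcal X\models^{\forall\exists}\psi$ iff for every $X\in\mathcal X$ there is $\chi\in X$ with $\chi\models_{LTL}\psi$; (2) $\mathcal X\models^\alpha\neg\phi$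 iff not $\mathcal X\models^{\bar\alpha}\phi$; (3) $\mathcal X\models^{\exists\forall}\phi_1\wedge\phi_2$ iff for every $(\mathcal X_1,\mathcal X_2)\in\mathrm{par}(\mathcal X)$, either ($\mathcal X_1\ne\emptyset$ and $\mathcal X_1\models^{\exists\forall}\phi_1$) or ($\mathcal X_2\ne\emptyset$ and $\mathcal X_2\models^{\exists\forall}\phi_2$); $\mathcal X\models^{\forall\exists}\phi_1\wedge\phi_2$ iff $\overline{\mathcal X}\models^{\exists\forall}\phi_1\wedge\phi_2$; (4) $\mathcal X\models^{\forall\exists}\phi_1\vee\phi_2$ iff there is $(\mathcal X_1,\mathcal X_2)\in\mathrm{par}(\mathcal X)$ such that ($\mathcal X_1\neq\emptyset$ implies $\mathcal X_1\models^{\forall\exists}\phi_1$) and ($\mathcal X_2\neq\emptyset$ implies $\mathcal X_2\models^{\forall\exists}\phi_2$); $\mathcal X\models^{\exists\forall}\phi_1\vee\phi_2$ iff $\overline{\mathcal X}\models^{\forall\exists}\phi_1\vee\phi_2$; (5) $\mathcal X\models^{\exists\forall}\exists p{:}\sigma.\phi$ iff $\mathrm{ext}_\sigma(\mathcal X,p)\models^{\exists\forall}\phi$; $\mathcal X\models^{\forall\exists}\exists p{:}\sigma.\phi$ iff $\overline{\mathcal X}\models^{\exists\forall}\exists p{:}\sigma.\phi$; (6) $\mathcal X\models^{\forall\exists}\forall p{:}\sigma.\phi$ iff $\mathrm{ext}_\sigma(\mathcal X,p)\models^{\forall\exists}\phi$; $\mathcal X\models^{\exists\forall}\forall p{:}\sigma.\phi$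 iff $\overline{\mathcal X}\models^{\forall\exists}\forall p{:}\sigma.\phi$. A GFG-QPTL formula $\varphi$ is $\alpha$-satisfiable if $\mathcal X\models^\alpha\varphi$ for some $\mathcal X\in\mathrm{HAsg}(\mathrm{free}(\varphi))$, and satisfiable if it is both $\exists\forall$- and $\forall\exists$-satisfiable. A sentence has no free propositions. A behavioral GFG-QPTL formula is one of the form $\wp\psi=Q_1^{\mathsf B}p_1.\cdots Q_n^{\mathsf B}p_n.\psi$ with $Q_i\in\{\exists,\forall\}$, pairwise distinct $p_i$, and $\psi$ LTL; $\mathrm{ap}(\wp)=\{p_1,\dots,p_n\}$. Words. For finite $P\subseteq AP$, $\mathrm{Val}(P)$ is the set of maps $P\to\mathbb B$; the word function $w:\mathrm{Asg}(P)\to\mathrm{Val}(P)^\omega$, $w(\chi)_t(p)=\chi(p)(t)$, is a bijection. Games. A game consists of disjoint sets of positions of Eloise and Abelard, an initial position, a move relation in which every position has a successor, a set $O$ of observable positions and a winning set $W\subseteq O^\omega$. A history is a finite path from the initial position; a strategy for a player maps each history ending in one of its positions to a successor of that position; a pair of strategies induces a unique infinite play; the observation of a play is the sequence of observable positions occurring in it, in order. Eloise wins if she has a strategy such that for every Abelard strategy the observation of the induced play lies in $W$; Abelard wins if he has a strategy such that for every Eloise strategy the observation is not in $W$. Quantification game $\mathcal G_{\wp,\Psi}$ for $\wp=Q_1^{\mathsf B}p_1\cdots Q_n^{\mathsf B}p_n$ (distinct $p_i$) and $\Psi\subseteq\mathrm{Asg}(\mathrm{ap}(\wp))$: positions are the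 valuations $v$ with domain $\{p_1,\dots,p_m\}$ for some $0\le m\le n$; $v$ belongs to Eloise iff $m<n$ and $Q_{m+1}=\exists$, otherwise to Abelard; the initial position is the empty valuation; moves go from $v$ with $m<n$ to any extension of $v$ with domain $\{p_1,\dots,p_{m+1}\}$, and from every total valuation ($m=n$) to the empty valuation; the observable positions are the total valuations $\mathrm{Val}(\mathrm{ap}(\wp))$; the winning set is $W=w(\Psi)$. *)

theory Defs
  imports Main "HOL-Library.Infinite_Set"
begin

type_synonym tval = "nat \<Rightarrow> bool"
type_synonym 'a asg = "'a \<Rightarrow> tval option"
type_synonym 'a hasg = "'a asg set set"

definition Asg :: "'a set \<Rightarrow> 'a asg set" where
  "Asg P = {\<chi>. dom \<chi> = P}"

definition HAsg :: "'a set \<Rightarrow> 'a hasg set" where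
  "HAsg P = {X. X \<noteq> {} \<and> {} \<notin> X \<and> (\<forall>Y\<in>X. Y \<subseteq> Asg P)}"

text \<open>ap(X): the common domain of the assignments in a hyperassignment.\<close>
definition hap :: "'a hasg \<Rightarrow> 'a set" where
  "hap X = dom (SOME \<chi>. \<exists>Y\<in>X. \<chi> \<in> Y)"

definition dual :: "'a hasg \<Rightarrow> 'a hasg" where
  "dual X = {c ` X | c. \<forall>Y\<in>X. c Y \<in> Y}"

definition par :: "'b set \<Rightarrow> ('b set \<times> 'b set) set" where
  "par X = {(X1, X2). X1 \<inter> X2 = {} \<and> X1 \<union> X2 = X}"

type_synonym 'a spec = "'a set \<times> 'a set"   \<comment> \<open>\<langle>P_B, P_S\<rangle>\<close>

definition agree_gt :: "'a set \<Rightarrow> 'a \<Rightarrow> nat \<Rightarrow> 'a asg \<Rightarrow> 'a asg \<Rightarrow> bool" where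
  "agree_gt P p k \<chi>1 \<chi>2 \<longleftrightarrow> (\<forall>q\<in>P - {p}. \<chi>1 q = \<chi>2 q) \<and>
      (\<forall>t\<le>k. the (\<chi>1 p) t = the (\<chi>2 p) t)"

definition agree_ge :: "'a set \<Rightarrow> 'a \<Rightarrow> nat \<Rightarrow> 'a asg \<Rightarrow> 'a asg \<Rightarrow> bool" where
  "agree_ge P p k \<chi>1 \<chi>2 \<longleftrightarrow> (\<forall>q\<in>P - {p}. \<chi>1 q = \<chi>2 q) \<and>
      (\<forall>t<k. the (\<chi>1 p) t = the (\<chi>2 p) t)"

text \<open>A functor over P is a function on Asg(P); only its values on Asg(P) matter.\<close>
definition behavioral :: "'a set \<Rightarrow> ('a asg \<Rightarrow> tval) \<Rightarrow> 'a \<Rightarrow> bool" where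
  "behavioral P F p \<longleftrightarrow> (\<forall>k \<chi>1 \<chi>2. \<chi>1 \<in> Asg P \<longrightarrow> \<chi>2 \<in> Asg P \<longrightarrow>
      agree_gt P p k \<chi>1 \<chi>2 \<longrightarrow> F \<chi>1 k = F \<chi>2 k)"

definition strongly_behavioral :: "'a set \<Rightarrow> ('a asg \<Rightarrow> tval) \<Rightarrow> 'a \<Rightarrow> bool" where
  "strongly_behavioral P F p \<longleftrightarrow> (\<forall>k \<chi>1 \<chi>2. \<chi>1 \<in> Asg P \<longrightarrow> \<chi>2 \<in> Asg P \<longrightarrow>
      agree_ge P p k \<chi>1 \<chi>2 \<longrightarrow> F \<chi>1 k = F \<chi>2 k)"

definition Fnc_spec :: "'a spec \<Rightarrow> 'a set \<Rightarrow> ('a asg \<Rightarrow> tval) set" where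
  "Fnc_spec \<sigma> P = {F. (\<forall>p\<in>fst \<sigma> \<inter> P. behavioral P F p) \<and>
                      (\<forall>p\<in>snd \<sigma> \<inter> P. strongly_behavioral P F p)}"

definition ext_asg :: "'a asg \<Rightarrow> ('a asg \<Rightarrow> tval) \<Rightarrow> 'a \<Rightarrow> 'a asg" where
  "ext_asg \<chi> F p = \<chi>(p \<mapsto> F \<chi>)"

definition ext_spec :: "'a spec \<Rightarrow> 'a hasg \<Rightarrow> 'a \<Rightarrow> 'a hasg" where
  "ext_spec \<sigma> X p = {(\<lambda>\<chi>. ext_asg \<chi> F p) ` Y | Y F. Y \<in> X \<and> F \<in> Fnc_spec \<sigma> (hap X)}"

definition spec_B :: "'a spec" where
  "spec_B = (UNIV, {})"

datatype 'a ltl = LTrue | LProp 'a | LNot "'a ltl" | LAnd "'a ltl" "'a ltl"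
  | LNext "'a ltl" | LUntil "'a ltl" "'a ltl"

primrec ltl_props :: "'a ltl \<Rightarrow> 'a set" where
  "ltl_props LTrue = {}"
| "ltl_props (LProp p) = {p}"
| "ltl_props (LNot a) = ltl_props a"
| "ltl_props (LAnd a b) = ltl_props a \<union> ltl_props b"
| "ltl_props (LNext a) = ltl_props a"
| "ltl_props (LUntil a b) = ltl_props a \<union> ltl_props b"

primrec ltl_holds :: "(nat \<Rightarrow> 'a \<Rightarrow> bool) \<Rightarrow> nat \<Rightarrow> 'a ltl \<Rightarrow> bool" where
  "ltl_holds w i LTrue = True"
| "ltl_holds w i (LProp p) = w i p"
| "ltl_holds w i (LNot a) = (\<not> ltl_holds w i a)"
| "ltl_holds w i (LAnd a b) = (ltl_holds w i a \<and> ltl_holds w i b)"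
| "ltl_holds w i (LNext a) = ltl_holds w (Suc i) a"
| "ltl_holds w i (LUntil a b) =
     (\<exists>j\<ge>i. ltl_holds w j b \<and> (\<forall>k. i \<le> k \<and> k < j \<longrightarrow> ltl_holds w k a))"

text \<open>The word of an assignment: the t-th letter is q \<mapsto> \<chi>(q)(t)
  (propositions outside the domain read as false; irrelevant when the domain
  covers the propositions of the formula).\<close>
definition asg_letters :: "'a asg \<Rightarrow> nat \<Rightarrow> 'a \<Rightarrow> bool" where
  "asg_letters \<chi> t q = (case \<chi> q of Some f \<Rightarrow> f t | None \<Rightarrow> False)"

definition ltl_models :: "'a asg \<Rightarrow> 'a ltl \<Rightarrow> bool" where
  "ltl_models \<chi> \<psi> \<longleftrightarrow> ltl_holds (asg_letters \<chi>) 0 \<psi>"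

datatype 'a gqptl = GLTL "'a ltl" | GNot "'a gqptl" | GAnd "'a gqptl" "'a gqptl"
  | GOr "'a gqptl" "'a gqptl" | GEx 'a "'a spec" "'a gqptl" | GAll 'a "'a spec" "'a gqptl"

primrec gfree :: "'a gqptl \<Rightarrow> 'a set" where
  "gfree (GLTL \<psi>) = ltl_props \<psi>"
| "gfree (GNot a) = gfree a"
| "gfree (GAnd a b) = gfree a \<union> gfree b"
| "gfree (GOr a b) = gfree a \<union> gfree b"
| "gfree (GEx p \<sigma> a) = gfree a - {p}"
| "gfree (GAll p \<sigma> a) = gfree a - {p}"

datatype flag = EA | AE

primrec flip :: "flag \<Rightarrow> flag" where
  "flip EA = AE" | "flip AE = EA"

primrec sem :: "'a gqptl \<Rightarrow> flag \<Rightarrow> 'a hasg \<Rightarrow> bool" where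
  "sem (GLTL \<psi>) \<alpha> X =
     (if \<alpha> = EA then (\<exists>Y\<in>X. \<forall>\<chi>\<in>Y. ltl_models \<chi> \<psi>)
      else (\<forall>Y\<in>X. \<exists>\<chi>\<in>Y. ltl_models \<chi> \<psi>))"
| "sem (GNot a) \<alpha> X = (\<not> sem a (flip \<alpha>) X)"
| "sem (GAnd a b) \<alpha> X =
     (let f = (\<lambda>Z. \<forall>(Z1, Z2)\<in>par Z. (Z1 \<noteq> {} \<and> sem a EA Z1) \<or> (Z2 \<noteq> {} \<and> sem b EA Z2))
      in if \<alpha> = EA then f X else f (dual X))"
| "sem (GOr a b) \<alpha> X =
     (let f = (\<lambda>Z. \<exists>(Z1, Z2)\<in>par Z. (Z1 \<noteq> {} \<longrightarrow> sem a AE Z1) \<and> (Z2 \<noteq> {} \<longrightarrow> sem b AE Z2))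
      in if \<alpha> = AE then f X else f (dual X))"
| "sem (GEx p \<sigma> a) \<alpha> X =
     (let f = (\<lambda>Z. sem a EA (ext_spec \<sigma> Z p))
      in if \<alpha> = EA then f X else f (dual X))"
| "sem (GAll p \<sigma> a) \<alpha> X =
     (let f = (\<lambda>Z. sem a AE (ext_spec \<sigma> Z p))
      in if \<alpha> = AE then f X else f (dual X))"

definition flag_satisfiable :: "flag \<Rightarrow> 'a gqptl \<Rightarrow> bool" where
  "flag_satisfiable \<alpha> \<phi> \<longleftrightarrow> (\<exists>X\<in>HAsg (gfree \<phi>). sem \<phi> \<alpha> X)"

definition satisfiable :: "'a gqptl \<Rightarrow> bool" where
  "satisfiable \<phi> \<longleftrightarrow> flag_satisfiable EA \<phi> \<and> flag_satisfiable AE \<phi>"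

datatype quant = QEx | QAll

definition behav_formula :: "(quant \<times> 'a) list \<Rightarrow> 'a ltl \<Rightarrow> 'a gqptl" where
  "behav_formula qs \<psi> =
     foldr (\<lambda>(Q, p) \<phi>. if Q = QEx then GEx p spec_B \<phi> else GAll p spec_B \<phi>) qs (GLTL \<psi>)"

record 'p game =
  posE :: "'p set"
  posA :: "'p set"
  init :: 'p
  moves :: "('p \<times> 'p) set"
  observable :: "'p set"
  winning :: "(nat \<Rightarrow> 'p) set"

definition is_history :: "'p game \<Rightarrow> 'p list \<Rightarrow> bool" where
  "is_history G h \<longleftrightarrow> h \<noteq> [] \<and> hd h = init G \<and>
     (\<forall>i. Suc i < length h \<longrightarrow> (h ! i, h ! Suc i) \<in> moves G)"

definition is_strategy :: "'p game \<Rightarrow> 'p set \<Rightarrow> ('p list \<Rightarrow> 'p) \<Rightarrow> bool" where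
  "is_strategy G S s \<longleftrightarrow> (\<forall>h. is_history G h \<longrightarrow> last h \<in> S \<longrightarrow> (last h, s h) \<in> moves G)"

primrec play_hist :: "'p game \<Rightarrow> ('p list \<Rightarrow> 'p) \<Rightarrow> ('p list \<Rightarrow> 'p) \<Rightarrow> nat \<Rightarrow> 'p list" where
  "play_hist G sE sA 0 = [init G]"
| "play_hist G sE sA (Suc n) =
     (let h = play_hist G sE sA n in h @ [if last h \<in> posE G then sE h else sA h])"

definition play :: "'p game \<Rightarrow> ('p list \<Rightarrow> 'p) \<Rightarrow> ('p list \<Rightarrow> 'p) \<Rightarrow> nat \<Rightarrow> 'p" where
  "play G sE sA n = last (play_hist G sE sA n)"

text \<open>Observation: the sequence of observable positions of a play, in order
  (None if only finitely many observable positions occur; such a play's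
  observation is not an element of O^omega, hence not in W).\<close>
definition observation :: "'p game \<Rightarrow> (nat \<Rightarrow> 'p) \<Rightarrow> (nat \<Rightarrow> 'p) option" where
  "observation G \<rho> =
     (let I = {i. \<rho> i \<in> observable G} in
      if infinite I then Some (\<lambda>k. \<rho> (enumerate I k)) else None)"

definition obs_winning :: "'p game \<Rightarrow> (nat \<Rightarrow> 'p) \<Rightarrow> bool" where
  "obs_winning G \<rho> \<longleftrightarrow> (\<exists>w. observation G \<rho> = Some w \<and> w \<in> winning G)"

definition eloise_wins :: "'p game \<Rightarrow> bool" where
  "eloise_wins G \<longleftrightarrow> (\<exists>sE. is_strategy G (posE G) sE \<and>
     (\<forall>sA. is_strategy G (posA G) sA \<longrightarrow> obs_winning G (play G sE sA)))"

definition abelard_wins :: "'p game \<Rightarrow> bool" where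
  "abelard_wins G \<longleftrightarrow> (\<exists>sA. is_strategy G (posA G) sA \<and>
     (\<forall>sE. is_strategy G (posE G) sE \<longrightarrow> \<not> obs_winning G (play G sE sA)))"

type_synonym 'a val = "'a \<Rightarrow> bool option"

definition word :: "'a asg \<Rightarrow> nat \<Rightarrow> 'a val" where
  "word \<chi> t = (\<lambda>p. map_option (\<lambda>f. f t) (\<chi> p))"

definition qgame :: "(quant \<times> 'a) list \<Rightarrow> 'a asg set \<Rightarrow> 'a val game" where
  "qgame qs \<Psi> =
    (let n = length qs; ps = map snd qs;
         Pos = {v. \<exists>m\<le>n. dom v = set (take m ps)};
         E = {v. \<exists>m<n. dom v = set (take m ps) \<and> fst (qs ! m) = QEx}
     in \<lparr> posE = E,
          posA = Pos - E,
          init = Map.empty,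
          moves = {(v, v'). \<exists>m<n. dom v = set (take m ps) \<and>
                              dom v' = set (take (Suc m) ps) \<and> v \<subseteq>\<^sub>m v'}
                  \<union> {(v, v'). dom v = set ps \<and> v' = Map.empty},
          observable = {v. dom v = set ps},
          winning = word ` \<Psi> \<rparr>)"

definition ltl_lang :: "'a set \<Rightarrow> 'a ltl \<Rightarrow> 'a asg set" where
  "ltl_lang P \<psi> = {\<chi> \<in> Asg P. ltl_models \<chi> \<psi>}"

end

theory Submission
  imports Defs "HOL-Library.Countable_Set"
begin

text \<open>Reading off one proposition at a time turns the quantification game into a game on Boolean
  sequences in which the owner of a move depends only on its number.  The language of an LTL formula
  is \<open>\<Sigma>\<^sup>0\<^sub>3\<close>: guess the set of until-subformulas that hold infinitely often and a time after which the
  others fail; given the guess, truth can be approximated by an open and by a closed condition that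
  agree if the guess is right, and rightness of the guess is \<open>\<Pi>\<^sup>0\<^sub>2\<close>.  Hence the game is determined by
  Davis' theorem.  A winning strategy of either player fixes the truth value of the formula under
  both flags: at each quantifier of its own the player uses the functor that simulates the strategy
  against the opponent's remaining functors, and the functor is behavioral because the simulation is
  causal.\<close>

section \<open>Determinacy of \<open>\<Sigma>\<^sup>0\<^sub>3\<close> games\<close>

text \<open>A winning strategy yields the truth value of the sentence, but no strategy is ever
  extracted from a satisfying evaluation. The converse directions come from determinacy: some player
  has a strategy, and both players cannot win. The obstacle is the order of choices. The quantifiers
  fix whole functors one after another, whereas a strategy for a proposition at time t may consult
  the earlier values of propositions quantified later, which do not exist yet when its functor is
  built. The simulation therefore runs against a fixed guess of how the opponent will play the later
  propositions. A behavioral functor sees the other propositions up to and including time t, which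
  is what the move order within a round allows. Guessing the until-subformulas replaces an automaton
  for the formula, and keeps the game at a level where determinacy has an elementary proof.\<close>

abbreviation pre :: "(nat \<Rightarrow> 'm) \<Rightarrow> nat \<Rightarrow> 'm list" where
  "pre x k \<equiv> map x [0..<k]"

lemma take_pre: "j \<le> k \<Longrightarrow> take j (pre x k) = pre x j"
  by (simp add: take_map)

section \<open>Quasi-strategy trees and the positions won inside them\<close>

locale sequence_game =
  fixes own :: "nat \<Rightarrow> bool"
begin

text \<open>A nondeterministic strategy of player II, who moves where \<open>own\<close> is false.
  Prefix closure is not demanded: a bad move of player I can lead from a lost position of II to one
  that is not lost.\<close>

definition quasi :: "'m list set \<Rightarrow> bool" where
  "quasi T \<longleftrightarrow> (\<forall>q\<in>T. if own (length q) then \<forall>a. q @ [a] \<in> T else \<exists>a. q @ [a] \<in> T)"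

definition follows :: "'m list set \<Rightarrow> 'm list \<Rightarrow> ('m list \<Rightarrow> 'm) \<Rightarrow> (nat \<Rightarrow> 'm) \<Rightarrow> bool" where
  "follows T p s x \<longleftrightarrow> pre x (length p) = p \<and>
     (\<forall>k\<ge>length p. pre x k \<in> T \<and> (own k \<longrightarrow> x k = s (pre x k)))"

text \<open>Player I wins from \<open>p\<close> inside \<open>T\<close>; vacuously so if
  \<open>p\<close> lies outside \<open>T\<close>, because \<open>follows\<close> requires
  \<open>p\<close> itself to be in \<open>T\<close>.\<close>

definition win :: "'m list set \<Rightarrow> ((nat \<Rightarrow> 'm) \<Rightarrow> bool) \<Rightarrow> 'm list \<Rightarrow> bool" where
  "win T A p \<longleftrightarrow> (\<exists>s. \<forall>x. follows T p s x \<longrightarrow> A x)"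

text \<open>Stated for tails, so that a tree entered late in a play still rules out
  \<open>B\<close>.\<close>

definition avoids :: "'m list set \<Rightarrow> ((nat \<Rightarrow> 'm) \<Rightarrow> bool) \<Rightarrow> bool" where
  "avoids T B \<longleftrightarrow> (\<forall>x k0. (\<forall>k\<ge>k0. pre x k \<in> T) \<longrightarrow> \<not> B x)"

definition nonlosing :: "'m list set \<Rightarrow> ((nat \<Rightarrow> 'm) \<Rightarrow> bool) \<Rightarrow> bool" where
  "nonlosing T A \<longleftrightarrow> quasi T \<and> (\<forall>q\<in>T. \<not> win T A q)"

text \<open>Strategies can be pasted: play \<open>s\<close> until the first prefix that is won, then
  commit to a chosen winning strategy for it. Taking the least switching point \<open>K r\<close>
  keeps the commitment unchanged at all later positions.\<close>

lemma win_switch: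
  assumes "\<And>x. follows T p s x \<Longrightarrow> A x \<or> (\<exists>k\<ge>length p. win T A (pre x k))"
  shows "win T A p"
proof -
  define S where "S q = (SOME s. \<forall>x. follows T q s x \<longrightarrow> A x)" for q
  have S: "A x" if "win T A q" "follows T q (S q) x" for q x
    using someI_ex[OF that(1)[unfolded win_def]] that(2) unfolding S_def by blast
  define K where "K r = (LEAST k. length p \<le> k \<and> win T A (take k r))" for r
  define \<sigma> where "\<sigma> r = (if \<exists>k\<ge>length p. k \<le> length r \<and> win T A (take k r)
    then S (take (K r) r) r else s r)" for r
  have "A x" if x: "follows T p \<sigma> x" for x
  proof (cases "\<exists>k\<ge>length p. win T A (pre x k)")
    case True
    define k0 where "k0 = (LEAST k. length p \<le> k \<and> win T A (pre x k))"
    have k0: "length p \<le> k0" "win T A (pre x k0)"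
      using LeastI_ex[OF True[unfolded Bex_def]] unfolding k0_def by auto
    have least: "\<not> win T A (pre x k)" if "length p \<le> k" "k < k0" for k
      using not_less_Least[of k "\<lambda>k. length p \<le> k \<and> win T A (pre x k)"] that unfolding k0_def by blast
    have "\<sigma> (pre x k) = S (pre x k0) (pre x k)" if "k \<ge> k0" for k
    proof -
      have "K (pre x k) = k0" unfolding K_def
      proof (rule Least_equality)
        show "length p \<le> k0 \<and> win T A (take k0 (pre x k))"
          using k0 that by (simp add: take_pre)
      next
        fix y assume y: "length p \<le> y \<and> win T A (take y (pre x k))"
        show "k0 \<le> y"
        proof (rule ccontr)
          assume "\<not> k0 \<le> y"
          then have "take y (pre x k) = pre x y" "y < k0" using that by (simp_all add: take_pre)
          with y least show False by metis
        qed
      qed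
      moreover have "\<exists>j\<ge>length p. j \<le> length (pre x k) \<and> win T A (take j (pre x k))"
        using k0 that by (intro exI[of _ k0]) (simp add: take_pre)
      ultimately show ?thesis using that unfolding \<sigma>_def by (simp add: take_pre)
    qed
    then have "follows T (pre x k0) (S (pre x k0)) x"
      using x k0 unfolding follows_def by auto
    then show ?thesis using S k0 by blast
  next
    case False
    have "\<sigma> (pre x k) = s (pre x k)" for k
    proof -
      have "\<not> (\<exists>j\<ge>length p. j \<le> length (pre x k) \<and> win T A (take j (pre x k)))"
        using False by (auto simp: take_pre)
      then show ?thesis unfolding \<sigma>_def by argo
    qed
    then have "follows T p s x" using x unfolding follows_def by simp
    with assms False show ?thesis by blast
  qed
  then show ?thesis unfolding win_def by blast
qed

lemma win_trivial: "(\<And>x. pre x (length p) = p \<Longrightarrow> A x) \<Longrightarrow> win T A p"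
  by (auto simp: win_def follows_def)

text \<open>If I had a move to a won position, or if all moves of II in \<open>T\<close> led to one,
  then \<open>win_switch\<close> would make the present position won.\<close>

lemma quasi_nonlosing_part:
  assumes "quasi T"
  shows "quasi {q\<in>T. \<not> win T A q}"
  unfolding quasi_def
proof (intro ballI)
  fix q assume "q \<in> {q\<in>T. \<not> win T A q}"
  then have q: "q \<in> T" "\<not> win T A q" by auto
  show "if own (length q) then \<forall>a. q @ [a] \<in> {q\<in>T. \<not> win T A q}
      else \<exists>a. q @ [a] \<in> {q\<in>T. \<not> win T A q}"
  proof (cases "own (length q)")
    case True
    have "\<not> win T A (q @ [a])" for a
    proof
      assume w: "win T A (q @ [a])"
      have "win T A q"
      proof (rule win_switch[where s = "\<lambda>_. a"])
        fix x assume "follows T q (\<lambda>_. a) x"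
        then have "pre x (Suc (length q)) = q @ [a]" using True by (auto simp: follows_def)
        with w show "A x \<or> (\<exists>k\<ge>length q. win T A (pre x k))" by (metis le_SucI order_refl)
      qed
      with q show False by blast
    qed
    then show ?thesis using True q assms by (auto simp: quasi_def)
  next
    case False
    have "\<exists>a. q @ [a] \<in> T \<and> \<not> win T A (q @ [a])"
    proof (rule ccontr)
      assume w: "\<not> (\<exists>a. q @ [a] \<in> T \<and> \<not> win T A (q @ [a]))"
      have "win T A q"
      proof (rule win_switch)
        fix x assume "follows T q undefined x"
        then have "pre x (Suc (length q)) \<in> T" "pre x (Suc (length q)) = q @ [x (length q)]"
          unfolding follows_def by (metis le_SucI order_refl, simp)
        with w show "A x \<or> (\<exists>k\<ge>length q. win T A (pre x k))" by (metis le_SucI order_refl)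
      qed
      with q show False by blast
    qed
    then show ?thesis using False by auto
  qed
qed

text \<open>Winning inside the smaller tree implies winning in \<open>T\<close>: a play that leaves
  it while staying in \<open>T\<close> has reached a won position.\<close>

lemma nonlosing_part:
  assumes "quasi T"
  shows "nonlosing {q\<in>T. \<not> win T A q} A" (is "nonlosing ?U A")
  unfolding nonlosing_def
proof (intro conjI ballI notI quasi_nonlosing_part assms)
  fix q assume q: "q \<in> ?U" and "win ?U A q"
  then obtain s where s: "\<And>x. follows ?U q s x \<Longrightarrow> A x" unfolding win_def by blast
  have "win T A q"
  proof (rule win_switch)
    fix x assume "follows T q s x"
    then show "A x \<or> (\<exists>k\<ge>length q. win T A (pre x k))"
      using s[of x] unfolding follows_def by blast
  qed
  with q show False by blast
qed

text \<open>Davis' lemma: against a nonlosing quasi-strategy tree, player II can in addition avoid a given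
  \<open>\<Pi>\<^sup>0\<^sub>2\<close> part \<open>B\<close> of player I's target.  From a position where II cannot, player I can force either a win
  or another visit to \<open>D\<close> at such a position; repeating this, player I wins.\<close>
lemma nonlosing_avoid:
  fixes D :: "'m list set"
  assumes T: "nonlosing T A"
    and B: "\<And>x. B x \<longleftrightarrow> infinite {k. pre x k \<in> D}"
    and BA: "\<And>x. B x \<Longrightarrow> A x"
    and p0: "p0 \<in> T"
  shows "\<exists>U\<subseteq>T. p0 \<in> U \<and> nonlosing U A \<and> avoids U B"
proof (rule ccontr)
  define good where "good p U \<longleftrightarrow> U \<subseteq> T \<and> p \<in> U \<and> nonlosing U A \<and> avoids U B" for p U
  define NG where "NG = {q\<in>T. \<nexists>U. good q U}"
  define U where "U q = (SOME U. good q U)" for q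
  have U: "good q (U q)" if "q \<in> T" "q \<notin> NG" for q
    using that someI_ex[of "good q"] unfolding NG_def U_def by blast
  assume "\<not> (\<exists>U\<subseteq>T. p0 \<in> U \<and> nonlosing U A \<and> avoids U B)"
  then have p0N: "p0 \<in> NG" using p0 unfolding NG_def good_def by blast
  \<comment> \<open>The next visit must come strictly after \<open>p\<close>, so that repeating the
    claim makes progress.\<close>
  define E where "E p x \<longleftrightarrow> A x \<or> (\<exists>k>length p. pre x k \<in> D \<inter> NG)" for p :: "'m list" and x
  have claim: "win T (E p) p" if p: "p \<in> NG" for p
  proof (rule ccontr)
    assume nw: "\<not> win T (E p) p"
    define W where "W = {q\<in>T. \<not> win T (E p) q}"
    have qT: "quasi T" using T by (simp add: nonlosing_def)
    have qW: "quasi W" unfolding W_def by (rule quasi_nonlosing_part[OF qT])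
    define hit where "hit r k \<longleftrightarrow> length p < k \<and> k \<le> length r \<and> take k r \<in> D \<inter> T - NG" for r k
    define first where "first r = (LEAST k. hit r k)" for r
    \<comment> \<open>\<open>V\<close> follows \<open>W\<close> until the first visit to
      \<open>D\<close> beyond \<open>p\<close> at which a good tree exists, and that tree from then
      on. If the claim failed, the nonlosing part of \<open>V\<close> would be good for
      \<open>p\<close>.\<close>
    define V where "V = {r\<in>T. if \<exists>k. hit r k then r \<in> U (take (first r) r) else r \<in> W}"
    \<comment> \<open>A visit to \<open>D\<close> inside \<open>NG\<close> beyond \<open>p\<close>
      fulfils \<open>E p\<close> at once, so visits to \<open>D\<close> in \<open>W\<close> beyond
      \<open>p\<close> are hits.\<close>
    have WD: "q \<notin> NG" if "q \<in> W" "q \<in> D" "length q > length p" for q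
    proof
      assume "q \<in> NG"
      then have "win T (E p) q" using that unfolding E_def by (intro win_trivial) (metis IntI)
      with that show False by (simp add: W_def)
    qed
    have first_hit: "hit r (first r)" if "hit r k" for r k
      unfolding first_def using that by (rule LeastI)
    have hit_app: "hit (r @ [a]) k \<longleftrightarrow> hit r k \<or> (k = Suc (length r) \<and> length p < k \<and> r @ [a] \<in> D \<inter> T - NG)"
      for r a k
      unfolding hit_def by (auto simp: le_Suc_eq)
    have first_app: "first (r @ [a]) = first r" if "hit r k" for r a k
    proof -
      have "hit (r @ [a]) (first r)" using first_hit[OF that] by (simp add: hit_app)
      moreover have "first r \<le> j" if "hit (r @ [a]) j" for j
      proof (cases "hit r j")
        case True then show ?thesis unfolding first_def by (rule Least_le)
      next
        case False
        then have "j = Suc (length r)" using that by (simp add: hit_app)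
        then show ?thesis using first_hit[OF \<open>hit r k\<close>] by (simp add: hit_def)
      qed
      ultimately show ?thesis unfolding first_def[of "r @ [a]"] by (intro Least_equality) auto
    qed
    have V_app: "r @ [a] \<in> V \<longleftrightarrow> r @ [a] \<in> U (take (first r) r)" if "r \<in> V" "hit r k" for r a k
    proof -
      have "take (first r) r \<in> T - NG" using first_hit[OF that(2)] by (auto simp: hit_def)
      then have "U (take (first r) r) \<subseteq> T" using U by (auto simp: good_def)
      moreover have "first r \<le> length r" using first_hit[OF that(2)] by (simp add: hit_def)
      moreover have "\<exists>k. hit (r @ [a]) k" using that(2) by (auto simp: hit_app)
      ultimately show ?thesis unfolding V_def using first_app[OF that(2)] by auto
    qed
    have V_hit: "r \<in> V" if "hit r (length r)" "\<And>k. k < length r \<Longrightarrow> \<not> hit r k" for r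
    proof -
      have "first r = length r" unfolding first_def using that by (intro Least_equality) (auto simp: not_less[symmetric])
      moreover have "r \<in> T" "r \<in> U r" using that(1) U[of r] by (auto simp: hit_def good_def)
      ultimately show ?thesis using that(1) unfolding V_def by auto
    qed
    have V_app2: "r @ [a] \<in> V" if "r @ [a] \<in> W" "\<nexists>k. hit r k" for r a
    proof (cases "\<exists>k. hit (r @ [a]) k")
      case True
      then have "hit (r @ [a]) (length (r @ [a]))" using that(2) by (auto simp: hit_app)
      moreover have "\<not> hit (r @ [a]) k" if "k < length (r @ [a])" for k
        using that \<open>\<nexists>k. hit r k\<close> by (auto simp: hit_app)
      ultimately show ?thesis by (rule V_hit)
    next
      case False
      then show ?thesis using that(1) unfolding V_def W_def by auto
    qed
    have qV: "quasi V"
      unfolding quasi_def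
    proof (intro ballI)
      fix r assume r: "r \<in> V"
      show "if own (length r) then \<forall>a. r @ [a] \<in> V else \<exists>a. r @ [a] \<in> V"
      proof (cases "\<exists>k. hit r k")
        case True
        then obtain k where k: "hit r k" ..
        have "take (first r) r \<in> T - NG" using first_hit[OF k] by (auto simp: hit_def)
        then have "quasi (U (take (first r) r))" using U by (auto simp: good_def nonlosing_def)
        moreover have "r \<in> U (take (first r) r)" using r True by (auto simp: V_def)
        ultimately show ?thesis unfolding V_app[OF r k] quasi_def by blast
      next
        case False
        then have "r \<in> W" using r by (auto simp: V_def)
        then show ?thesis using qW V_app2[OF _ False] unfolding quasi_def by meson
      qed
    qed
    \<comment> \<open>A play that ends up in \<open>V\<close> and visits \<open>D\<close> infinitely
      often has a hit, and then stays in a tree avoiding \<open>B\<close>.\<close>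
    have aV: "avoids V B"
      unfolding avoids_def
    proof (intro allI impI notI)
      fix x k0 assume x: "\<forall>k\<ge>k0. pre x k \<in> V" and "B x"
      then obtain k1 where "k1 > max k0 (length p)" "pre x k1 \<in> D"
        using B[of x] unfolding infinite_nat_iff_unbounded by blast
      then have k1: "k1 \<ge> k0" "k1 > length p" "pre x k1 \<in> D" by auto
      have "\<exists>k. hit (pre x k1) k"
      proof (rule ccontr)
        assume n: "\<nexists>k. hit (pre x k1) k"
        then have "pre x k1 \<in> W" using x k1 by (auto simp: V_def)
        with k1 WD[of "pre x k1"] have "hit (pre x k1) k1" by (auto simp: hit_def W_def)
        with n show False by blast
      qed
      then obtain k where k: "hit (pre x k1) k" ..
      define k' where "k' = first (pre x k1)"
      have k'h: "hit (pre x k1) k'" unfolding k'_def by (rule first_hit[OF k])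
      then have k': "k' \<le> k1" "pre x k' \<in> T - NG" by (auto simp: hit_def take_pre)
      have F: "hit (pre x j) k' \<and> first (pre x j) = k'" if "j \<ge> k1" for j
        using that
      proof (induction j rule: dec_induct)
        case base then show ?case using k'h k'_def by simp
      next
        case (step j)
        then show ?case using first_app[of "pre x j" k' "x j"] by (auto simp: hit_app)
      qed
      have "pre x j \<in> U (pre x k')" if "j \<ge> k1" for j
      proof -
        have "pre x j \<in> V" "take (first (pre x j)) (pre x j) = pre x k'" "\<exists>k. hit (pre x j) k"
          using F[OF that] x that k1(1) k'(1) by (auto simp: take_pre)
        then show ?thesis by (simp add: V_def)
      qed
      moreover have "avoids (U (pre x k')) B" using U k'(2) by (auto simp: good_def)
      ultimately show False using \<open>B x\<close> unfolding avoids_def by blast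
    qed
    have pV: "p \<in> V" using p nw unfolding V_def W_def NG_def by (auto simp: hit_def)
    \<comment> \<open>A strategy \<open>s\<close> winning \<open>A\<close> in \<open>V\<close> would
      win \<open>E p\<close> in \<open>T\<close>. A play leaving \<open>V\<close> has had no hit
      before, since \<open>s\<close> would then win inside the nonlosing tree of the first hit; so
      it leaves \<open>W\<close>, and \<open>E p\<close> is won there.\<close>
    have nwV: "\<not> win V A p"
    proof
      assume "win V A p"
      then obtain s where s: "\<And>x. follows V p s x \<Longrightarrow> A x" unfolding win_def by blast
      have "win T (E p) p"
      proof (rule win_switch)
        fix x assume x: "follows T p s x"
        show "E p x \<or> (\<exists>k\<ge>length p. win T (E p) (pre x k))"
        proof (cases "\<forall>k\<ge>length p. pre x k \<in> V")
          case True
          then have "follows V p s x" using x by (auto simp: follows_def)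
          then show ?thesis using s unfolding E_def by blast
        next
          case False
          define k1 where "k1 = (LEAST k. k \<ge> length p \<and> pre x k \<notin> V)"
          have k1: "k1 \<ge> length p" "pre x k1 \<notin> V"
            using LeastI_ex[of "\<lambda>k. k \<ge> length p \<and> pre x k \<notin> V"] False unfolding k1_def by auto
          have before: "pre x k \<in> V" if "k \<ge> length p" "k < k1" for k
            using not_less_Least[of k "\<lambda>k. k \<ge> length p \<and> pre x k \<notin> V"] that unfolding k1_def by blast
          have nohit: "\<not> hit (pre x k1) k" if "k < k1" for k
          proof
            assume "hit (pre x k1) k"
            define k' where "k' = (LEAST k. hit (pre x k1) k)"
            have h: "hit (pre x k1) k'" unfolding k'_def by (rule LeastI) fact
            have "k' \<le> k" unfolding k'_def by (rule Least_le) fact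
            then have k'1: "k' < k1" using that by simp
            have nh: "\<not> hit (pre x k1) j" if "j < k'" for j
              using that not_less_Least unfolding k'_def by blast
            define q where "q = pre x k'"
            have q: "q \<in> T - NG" "length q > length p" "length q = k'"
              using h k'1 by (auto simp: hit_def q_def take_pre)
            have gq: "good q (U q)" using U q(1) by blast
            have "win (U q) A q"
              unfolding win_def
            proof (intro exI allI impI)
              fix y assume y: "follows (U q) q s y"
              then have yq: "pre y k' = q" using q(3) by (simp add: follows_def)
              have eqxy: "x j = y j" if "j < k'" for j
                using yq that unfolding q_def by (metis (no_types, lifting) add_0 length_map length_upt minus_nat.diff_0 nth_map nth_upt)
              have prexy: "pre y j = pre x j" if "j \<le> k'" for j
                using that eqxy by simp
              have nh': "\<not> hit (pre y j) i" if "i < k'" for i j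
              proof
                assume a: "hit (pre y j) i"
                then have "i \<le> j" by (simp add: hit_def)
                then have "hit (pre x k1) i" using a that k'1 prexy[of i] unfolding hit_def by (simp add: take_pre)
                with nh that show False by blast
              qed
              have hy: "hit (pre y j) k'" if "j \<ge> k'" for j
                using h that k'1 yq unfolding q_def hit_def by (simp add: take_pre del: map_eq_conv)
              have fy: "first (pre y j) = k'" if "j \<ge> k'" for j
                unfolding first_def using hy[OF that] nh' by (intro Least_equality) (auto simp: not_less[symmetric])
              have "pre y j \<in> V" if "j \<ge> length p" for j
              proof (cases "j < k'")
                case True
                then show ?thesis using before[OF that] k'1 prexy[of j] by (simp del: map_eq_conv)
              next
                case False
                then have j: "j \<ge> k'" by simp
                have "pre y j \<in> U q" using y j q(3) by (auto simp: follows_def)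
                moreover have "U q \<subseteq> T" using gq by (simp add: good_def)
                ultimately show ?thesis using hy[OF j] fy[OF j] yq j unfolding V_def by (auto simp: take_pre)
              qed
              moreover have "own j \<longrightarrow> y j = s (pre y j)" if "j \<ge> length p" for j
              proof (cases "j < k'")
                case True
                have "own j \<longrightarrow> x j = s (pre x j)" using x that by (simp add: follows_def)
                then show ?thesis using eqxy[OF True] prexy[of j] True by (metis less_imp_le)
              next
                case False
                then show ?thesis using y q(3) by (simp add: follows_def)
              qed
              moreover have "pre y (length p) = p"
                using prexy[of "length p"] q x by (simp add: follows_def del: map_eq_conv)
              ultimately have "follows V p s y" by (simp add: follows_def)
              then show "A y" by (rule s)
            qed
            moreover have "\<not> win (U q) A q" using gq by (simp add: good_def nonlosing_def)
            ultimately show False by blast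
          qed
          have "\<not> hit (pre x k1) k1"
            using V_hit[of "pre x k1"] nohit k1(2) by auto
          then have "\<nexists>k. hit (pre x k1) k" using nohit by (metis hit_def diff_zero length_map length_upt linorder_cases not_less)
          moreover have "pre x k1 \<in> T" using x k1 by (auto simp: follows_def)
          ultimately have "pre x k1 \<notin> W" using k1(2) by (auto simp: V_def split: if_splits)
          then have "win T (E p) (pre x k1)" using \<open>pre x k1 \<in> T\<close> by (simp add: W_def)
          then show ?thesis using k1(1) by blast
        qed
      qed
      with nw show False by blast
    qed
    have "V \<subseteq> T" unfolding V_def by blast
    moreover have "avoids {q\<in>V. \<not> win V A q} B" using aV unfolding avoids_def by blast
    ultimately have "good p {q\<in>V. \<not> win V A q}"
      unfolding good_def using pV nwV nonlosing_part[OF qV, of A] by blast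
    then show False using p by (auto simp: NG_def)
  qed
  define S where "S q = (SOME s. \<forall>x. follows T q s x \<longrightarrow> E q x)" for q
  have S: "E q x" if "q \<in> NG" "follows T q (S q) x" for q x
    using someI_ex[OF claim[OF that(1), unfolded win_def]] that(2) unfolding S_def by blast
  define ls where "ls r = {k. k \<le> length r \<and> (k = length p0 \<or> length p0 < k \<and> take k r \<in> D \<inter> NG)}" for r
  \<comment> \<open>Player I follows the strategy of the claim for the last position of
    \<open>D \<inter> NG\<close> visited after \<open>p0\<close>, or for \<open>p0\<close> itself if
    there is none.\<close>
  define \<sigma> where "\<sigma> r = S (take (Max (ls r)) r) r" for r
  have "win T A p0"
    unfolding win_def
  proof (intro exI allI impI)
    fix x assume x: "follows T p0 \<sigma> x"
    show "A x"
    proof (cases "B x")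
      case True then show ?thesis by (rule BA)
    next
      case False
      \<comment> \<open>Outside \<open>B\<close> the set \<open>D\<close> is visited finitely often,
        so the strategy changes finitely often. After the last change only the alternative
        \<open>A x\<close> of \<open>E\<close> remains.\<close>
      define M where "M = {k. k = length p0 \<or> length p0 < k \<and> pre x k \<in> D \<inter> NG}"
      have "M \<subseteq> insert (length p0) {k. pre x k \<in> D}" unfolding M_def by auto
      moreover have "finite {k. pre x k \<in> D}" using False B by simp
      ultimately have fM: "finite M" using finite_subset by blast
      define m where "m = Max M"
      have mM: "m \<in> M" unfolding m_def using fM by (intro Max_in) (auto simp: M_def)
      then have mp: "m \<ge> length p0" by (auto simp: M_def)
      have "Max (ls (pre x k)) = m" if "k \<ge> m" for k
      proof (rule Max_eqI)
        show "finite (ls (pre x k))" by (rule finite_subset[of _ "{..k}"]) (auto simp: ls_def)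
        show "m \<in> ls (pre x k)" using mM that by (auto simp: M_def ls_def take_pre)
        fix y assume "y \<in> ls (pre x k)"
        then have "y \<in> M" by (auto simp: ls_def M_def take_pre)
        then show "y \<le> m" unfolding m_def using fM by simp
      qed
      then have "follows T (pre x m) (S (pre x m)) x"
        using x mp unfolding follows_def \<sigma>_def by (auto simp: take_pre)
      moreover have "pre x m \<in> NG"
        using mM x p0N unfolding M_def follows_def by auto
      ultimately have "E (pre x m) x" by (rule S[rotated])
      moreover have "pre x k \<notin> D \<inter> NG" if "k > m" for k
      proof
        assume "pre x k \<in> D \<inter> NG"
        then have "k \<in> M" using that mp by (auto simp: M_def)
        then have "k \<le> m" unfolding m_def using fM by simp
        with that show False by simp
      qed
      ultimately show ?thesis unfolding E_def by auto
    qed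
  qed
  with T p0 show False by (auto simp: nonlosing_def)
qed

text \<open>The disjunction in case \<open>II\<close> exempts from \<open>s\<close> the moves that \<open>T\<close> forces, such as dummy moves.\<close>
theorem sigma3_determinacy:
  assumes "quasi T" "[] \<in> T"
    and A: "\<And>x. A x \<longleftrightarrow> (\<exists>n::nat. infinite {k. pre x k \<in> D n})"
  obtains (I) s where "\<And>x. (\<And>k. pre x k \<in> T) \<Longrightarrow> (\<And>k. own k \<Longrightarrow> x k = s (pre x k)) \<Longrightarrow> A x"
  | (II) s where "\<And>x. (\<And>k. pre x k \<in> T) \<Longrightarrow>
      (\<And>k. \<not> own k \<Longrightarrow> x k = s (pre x k) \<or> (\<forall>a. pre x k @ [a] \<in> T \<longrightarrow> a = x k)) \<Longrightarrow> \<not> A x"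
proof (cases "win T A []")
  case True
  then obtain s where "\<And>x. follows T [] s x \<Longrightarrow> A x" unfolding win_def by blast
  then show ?thesis by (intro I[of s]) (simp add: follows_def)
next
  case False
  define B where "B n x \<longleftrightarrow> infinite {k. pre x k \<in> D n}" for n x
  define next_tree where
    "next_tree V r = (SOME U. U \<subseteq> V \<and> r \<in> U \<and> nonlosing U A \<and> avoids U (B (length r)))" for V r
  have nt: "next_tree V r \<subseteq> V \<and> r \<in> next_tree V r \<and> nonlosing (next_tree V r) A \<and>
      avoids (next_tree V r) (B (length r))" if "nonlosing V A" "r \<in> V" for V r
  proof -
    have "\<exists>U\<subseteq>V. r \<in> U \<and> nonlosing U A \<and> avoids U (B (length r))"
      using that by (intro nonlosing_avoid[where D = "D (length r)"]) (auto simp: A B_def)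
    then show ?thesis unfolding next_tree_def by (rule someI_ex)
  qed
  define T0 where "T0 = {q\<in>T. \<not> win T A q}"
  have T0: "nonlosing T0 A" "[] \<in> T0"
    unfolding T0_def using nonlosing_part[OF assms(1)] assms(2) False by auto
  \<comment> \<open>One set is handled per move: along the play, the tree in force after
    \<open>k\<close> moves avoids \<open>B 0\<close> up to \<open>B k\<close>. It is chosen anew at
    each position because a shrunken tree need only retain the current one.\<close>
  define tree where "tree = rec_nat (\<lambda>r. next_tree T0 []) (\<lambda>k f r. next_tree (f r) (take (Suc k) r))"
  have tree_0: "tree 0 r = next_tree T0 []" and
    tree_Suc: "tree (Suc k) r = next_tree (tree k r) (take (Suc k) r)" for k r
    by (simp_all add: tree_def)
  have tree_cong: "tree k r = tree k r'" if "take k r = take k r'" for k r r'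
    using that
  proof (induction k)
    case (Suc k)
    then have "take k r = take k r'" by (metis min.absorb1 le_SucI order_refl take_take)
    with Suc show ?case by (simp add: tree_Suc)
  qed (simp add: tree_0)
  define s where "s r = (SOME a. r @ [a] \<in> tree (length r) r)" for r
  show ?thesis
  proof (rule II)
    fix x assume xT: "\<And>k. pre x k \<in> T" and
      x: "\<And>k. \<not> own k \<Longrightarrow> x k = s (pre x k) \<or> (\<forall>a. pre x k @ [a] \<in> T \<longrightarrow> a = x k)"
    define V where "V k = tree k (pre x k)" for k
    have V_Suc: "V (Suc k) = next_tree (V k) (pre x (Suc k))" for k
      unfolding V_def tree_Suc using tree_cong[of k "pre x (Suc k)" "pre x k"]
      by (simp add: take_pre del: upt_Suc)
    have step: "pre x (Suc k) \<in> V k" if "pre x k \<in> V k" "V k \<subseteq> T0" "nonlosing (V k) A" for k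
    proof (cases "own k")
      case True
      then show ?thesis using that unfolding nonlosing_def quasi_def by force
    next
      case False
      then have ex: "\<exists>a. pre x k @ [a] \<in> V k" using that unfolding nonlosing_def quasi_def by force
      from x[OF False] have "pre x k @ [x k] \<in> V k"
      proof
        assume "x k = s (pre x k)"
        then show ?thesis using someI_ex[OF ex] unfolding s_def V_def by simp
      next
        assume "\<forall>a. pre x k @ [a] \<in> T \<longrightarrow> a = x k"
        then show ?thesis using ex that(2) unfolding T0_def by blast
      qed
      then show ?thesis by simp
    qed
    have inv: "pre x k \<in> V k \<and> V k \<subseteq> T0 \<and> nonlosing (V k) A \<and> avoids (V k) (B k)" for k
    proof (induction k)
      case 0
      then show ?case using nt[OF T0] by (simp add: V_def tree_0)
    next
      case (Suc k)
      with nt[of "V k" "pre x (Suc k)"] step[of k] show ?case unfolding V_Suc by auto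
    qed
    \<comment> \<open>The trees decrease, so from move \<open>k\<close> on the whole play stays in
      \<open>V k\<close>.\<close>
    have "V (Suc k) \<subseteq> V k" for k
      using nt[of "V k" "pre x (Suc k)"] step[of k] inv[of k] unfolding V_Suc by blast
    then have "V j \<subseteq> V k" if "j \<ge> k" for j k
      using that by (rule lift_Suc_antimono_le)
    then have "\<forall>j\<ge>k. pre x j \<in> V k" for k using inv by blast
    then have "\<not> B k x" for k using inv[of k] unfolding avoids_def by blast
    then show "\<not> A x" unfolding A B_def by blast
  qed
qed

end

section \<open>LTL languages are \<open>\<Sigma>\<^sup>0\<^sub>3\<close>\<close>

definition open_pred :: "((nat \<Rightarrow> 'm) \<Rightarrow> bool) \<Rightarrow> bool" where
  "open_pred P \<longleftrightarrow> (\<forall>x. P x \<longrightarrow> (\<exists>n. \<forall>y. pre y n = pre x n \<longrightarrow> P y))"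

definition gdelta :: "((nat \<Rightarrow> 'm) \<Rightarrow> bool) \<Rightarrow> bool" where
  "gdelta P \<longleftrightarrow> (\<exists>U :: nat \<Rightarrow> _. (\<forall>n. open_pred (U n)) \<and> P = (\<lambda>x. \<forall>n. U n x))"

lemma pre_eq_mono: "pre y n = pre x n \<Longrightarrow> m \<le> n \<Longrightarrow> pre y m = pre x m"
  by (metis take_pre)

lemma open_pred_const: "open_pred (\<lambda>x. c)"
  by (simp add: open_pred_def)

lemma open_pred_ex: "(\<And>i. open_pred (P i)) \<Longrightarrow> open_pred (\<lambda>x. \<exists>i. P i x)"
  unfolding open_pred_def by meson

lemma open_pred_conj: "open_pred P \<Longrightarrow> open_pred Q \<Longrightarrow> open_pred (\<lambda>x. P x \<and> Q x)"
  unfolding open_pred_def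
proof (intro allI impI)
  fix x assume PQ: "\<forall>x. P x \<longrightarrow> (\<exists>n. \<forall>y. pre y n = pre x n \<longrightarrow> P y)"
    "\<forall>x. Q x \<longrightarrow> (\<exists>n. \<forall>y. pre y n = pre x n \<longrightarrow> Q y)" and "P x \<and> Q x"
  then obtain m n where "\<forall>y. pre y m = pre x m \<longrightarrow> P y" "\<forall>y. pre y n = pre x n \<longrightarrow> Q y" by blast
  then show "\<exists>n. \<forall>y. pre y n = pre x n \<longrightarrow> P y \<and> Q y"
    by (intro exI[of _ "max m n"]) (metis max.cobounded1 max.cobounded2 pre_eq_mono)
qed

lemma open_pred_disj: "open_pred P \<Longrightarrow> open_pred Q \<Longrightarrow> open_pred (\<lambda>x. P x \<or> Q x)"
  unfolding open_pred_def by meson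

lemma open_pred_ball: "finite I \<Longrightarrow> (\<And>i. i \<in> I \<Longrightarrow> open_pred (P i)) \<Longrightarrow> open_pred (\<lambda>x. \<forall>i\<in>I. P i x)"
  by (induction I rule: finite_induct) (auto intro!: open_pred_const open_pred_conj)

lemma gdelta_open: "open_pred P \<Longrightarrow> gdelta P"
  unfolding gdelta_def by (intro exI[of _ "\<lambda>_. P"]) simp

lemma gdelta_all:
  assumes "\<And>i::nat. gdelta (P i)"
  shows "gdelta (\<lambda>x. \<forall>i. P i x)"
proof -
  obtain U where U: "\<And>i n. open_pred (U i n)" "\<And>i. P i = (\<lambda>x. \<forall>n::nat. U i n x)"
    using assms unfolding gdelta_def by metis
  show ?thesis unfolding gdelta_def
  proof (intro exI conjI allI)
    show "open_pred ((\<lambda>k. case prod_decode k of (i, n) \<Rightarrow> U i n) k)" for k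
      using U(1) by (simp split: prod.split)
    have "(\<forall>k. case prod_decode k of (i, n) \<Rightarrow> U i n x) \<longleftrightarrow> (\<forall>i n. U i n x)" for x
      by (metis (mono_tags, lifting) case_prod_conv old.prod.exhaust prod_encode_inverse)
    then show "(\<lambda>x. \<forall>i. P i x) = (\<lambda>x. \<forall>k. (case prod_decode k of (i, n) \<Rightarrow> U i n) x)"
      by (auto simp: U(2) split_def fun_eq_iff)
  qed
qed

lemma gdelta_conj:
  assumes "gdelta P" "gdelta Q"
  shows "gdelta (\<lambda>x. P x \<and> Q x)"
proof -
  have "gdelta (\<lambda>x. \<forall>i::nat. (if i = 0 then P else Q) x)"
    by (intro gdelta_all) (simp add: assms)
  moreover have "(\<forall>i::nat. (if i = 0 then P else Q) x) \<longleftrightarrow> P x \<and> Q x" for x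
    by (auto split: if_splits)
  ultimately show ?thesis by simp
qed

lemma gdelta_ball:
  "finite I \<Longrightarrow> (\<And>i. i \<in> I \<Longrightarrow> gdelta (P i)) \<Longrightarrow> gdelta (\<lambda>x. \<forall>i\<in>I. P i x)"
  by (induction I rule: finite_induct) (auto intro: gdelta_open open_pred_const gdelta_conj)

text \<open>A closed set is the intersection over \<open>n\<close> of the open sets of sequences
  sharing their first \<open>n\<close> entries with a member.\<close>

lemma gdelta_closed:
  assumes "open_pred (\<lambda>x. \<not> P x)"
  shows "gdelta P"
  unfolding gdelta_def
proof (intro exI conjI allI)
  show "open_pred ((\<lambda>n x. \<exists>y. pre y n = pre x n \<and> P y) n)" for n
    unfolding open_pred_def by metis
  have "P x" if "\<forall>n. \<exists>y. pre y n = pre x n \<and> P y" for x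
    using assms that unfolding open_pred_def by blast
  then show "P = (\<lambda>x. \<forall>n. \<exists>y. pre y n = pre x n \<and> P y)" by fastforce
qed

text \<open>The witness consists of the prefixes at which one more of the open sets becomes certain.\<close>
lemma gdelta_infinitely_often:
  assumes "gdelta P"
  obtains D where "\<And>x. P x \<longleftrightarrow> infinite {k. pre x k \<in> D}"
proof -
  obtain U where op: "\<And>n. open_pred (U n)" and P: "P = (\<lambda>x. \<forall>n::nat. U n x)"
    using assms unfolding gdelta_def by auto
  define sure where "sure r n \<longleftrightarrow> (\<forall>m<n. \<forall>y. pre y (length r) = r \<longrightarrow> U m y)" for r :: "'a list" and n
  \<comment> \<open>\<open>sure r n\<close> says that the cylinder of \<open>r\<close> lies in the
    first \<open>n\<close> open sets. Bounding \<open>n\<close> by the length makes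
    \<open>Max\<close> range over a finite set; this only delays the growth of
    \<open>lev\<close>.\<close>
  define lev where "lev r = Max {n. n \<le> length r \<and> sure r n}" for r :: "'a list"
  define D where "D = {r. r \<noteq> [] \<and> lev (butlast r) < lev r}"
  have fin: "finite {n. n \<le> length r \<and> sure r n}" for r :: "'a list" by simp
  have lev: "lev r \<le> length r \<and> sure r (lev r)" for r
  proof -
    have "0 \<in> {n. n \<le> length r \<and> sure r n}" by (simp add: sure_def)
    then show ?thesis using Max_in[OF fin[of r]] unfolding lev_def by blast
  qed
  have lev_ge: "n \<le> lev r" if "n \<le> length r" "sure r n" for n r
    using fin that unfolding lev_def by (intro Max_ge) auto
  have sure_mono: "sure (pre x j) n" if "sure (pre x k) n" "k \<le> j" for x j k n
    unfolding sure_def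
  proof (intro allI impI)
    fix m y assume "m < n" "pre y (length (pre x j)) = pre x j"
    then have "pre y k = pre x k" using that(2) pre_eq_mono[of y j x k] by simp
    then show "U m y" using that(1) \<open>m < n\<close> unfolding sure_def by simp
  qed
  have mono: "lev (pre x k) \<le> lev (pre x j)" if "k \<le> j" for x j k
    using lev[of "pre x k"] sure_mono[OF _ that] that by (intro lev_ge) auto
  have "P x \<longleftrightarrow> infinite {k. pre x k \<in> D}" for x
  proof
    assume "P x"
    have big: "\<exists>k. lev (pre x k) \<ge> n" for n
    proof -
      have "\<exists>k. sure (pre x k) n"
      proof (induction n)
        case (Suc n)
        then obtain k where k: "sure (pre x k) n" by blast
        from \<open>P x\<close> op[of n] obtain m where m: "\<forall>y. pre y m = pre x m \<longrightarrow> U n y"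
          unfolding P open_pred_def by blast
        have "sure (pre x (max k m)) n" using k by (rule sure_mono) simp
        moreover have "\<forall>y. pre y (max k m) = pre x (max k m) \<longrightarrow> U n y"
          using m pre_eq_mono by (metis max.cobounded2)
        ultimately have "sure (pre x (max k m)) (Suc n)" by (auto simp: sure_def less_Suc_eq)
        then show ?case ..
      qed (auto simp: sure_def)
      then obtain k where "sure (pre x k) n" ..
      then have "sure (pre x (max k n)) n" by (rule sure_mono) simp
      then have "n \<le> lev (pre x (max k n))" by (intro lev_ge) simp_all
      then show ?thesis ..
    qed
    show "infinite {k. pre x k \<in> D}"
      unfolding infinite_nat_iff_unbounded
    proof
      fix m
      obtain k where k: "lev (pre x k) > lev (pre x m)"
        using big[of "Suc (lev (pre x m))"] unfolding Suc_le_eq by blast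
      define j where "j = (LEAST j. lev (pre x j) > lev (pre x m))"
      have j: "lev (pre x j) > lev (pre x m)" unfolding j_def using k by (rule LeastI)
      then have "j > m" using mono[of j m x] by (meson leD not_le)
      then obtain i where i: "j = Suc i" by (cases j) auto
      have "\<not> lev (pre x i) > lev (pre x m)"
        using not_less_Least[of i "\<lambda>j. lev (pre x j) > lev (pre x m)"] i unfolding j_def by simp
      then have "pre x j \<in> D" using j by (simp add: D_def i)
      then show "\<exists>n>m. n \<in> {k. pre x k \<in> D}" using \<open>j > m\<close> by auto
    qed
  next
    assume inf: "infinite {k. pre x k \<in> D}"
    have "\<exists>k. lev (pre x k) \<ge> n" for n
    proof (induction n)
      case (Suc n)
      then obtain k where k: "lev (pre x k) \<ge> n" ..
      obtain j where j: "j > k" "pre x j \<in> D" using inf unfolding infinite_nat_iff_unbounded by auto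
      then obtain i where i: "j = Suc i" by (cases j) auto
      have "lev (pre x k) \<le> lev (pre x i)" using j i by (intro mono) simp
      moreover have "lev (pre x i) < lev (pre x j)" using j(2) by (simp add: D_def i)
      ultimately have "Suc n \<le> lev (pre x j)" using k by simp
      then show ?case ..
    qed simp
    then show "P x" unfolding P
      using lev by (metis Suc_le_lessD length_map length_upt minus_nat.diff_0 sure_def)
  qed
  with that show ?thesis by blast
qed

text \<open>\<open>approx X N w False i\<close> is an open lower and \<open>approx X N w True i\<close> a closed upper approximation of
  truth at time \<open>i\<close>, given a guess \<open>X\<close> of the until-formulas that hold infinitely often and a time \<open>N\<close>
  from which on the other until-formulas fail.\<close>
primrec approx :: "'a ltl set \<Rightarrow> nat \<Rightarrow> (nat \<Rightarrow> 'a \<Rightarrow> bool) \<Rightarrow> bool \<Rightarrow> nat \<Rightarrow> 'a ltl \<Rightarrow> bool" where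
  "approx X N w u i LTrue = True"
| "approx X N w u i (LProp p) = w i p"
| "approx X N w u i (LNot a) = (\<not> approx X N w (\<not> u) i a)"
| "approx X N w u i (LAnd a b) = (approx X N w u i a \<and> approx X N w u i b)"
| "approx X N w u i (LNext a) = approx X N w u (Suc i) a"
| "approx X N w u i (LUntil a b) =
    (if u \<and> LUntil a b \<in> X
     then \<forall>j. j < i \<or> approx X N w u j a \<or> (\<exists>k\<in>{i..j}. approx X N w u k b)
     else \<exists>j. j \<ge> i \<and> (u \<longrightarrow> j < N) \<and> approx X N w u j b \<and> (\<forall>k\<in>{i..<j}. approx X N w u k a))"

primrec untils :: "'a ltl \<Rightarrow> 'a ltl set" where
  "untils LTrue = {}"
| "untils (LProp p) = {}"
| "untils (LNot a) = untils a"
| "untils (LAnd a b) = untils a \<union> untils b"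
| "untils (LNext a) = untils a"
| "untils (LUntil a b) = insert (LUntil a b) (untils a \<union> untils b)"

lemma finite_untils: "finite (untils \<psi>)"
  by (induction \<psi>) auto

text \<open>The left side is the weak until. Once \<open>Q\<close> is bound to occur, its first
  occurrence is a witness for the strong one.\<close>

lemma weak_until_eq:
  assumes "\<exists>j\<ge>i::nat. Q j"
  shows "(\<forall>j. j < i \<or> P j \<or> (\<exists>k\<in>{i..j}. Q k)) \<longleftrightarrow> (\<exists>j\<ge>i. Q j \<and> (\<forall>k. i \<le> k \<and> k < j \<longrightarrow> P k))"
    (is "?W \<longleftrightarrow> ?U")
proof
  assume W: ?W
  define j where "j = (LEAST j. i \<le> j \<and> Q j)"
  have j: "i \<le> j" "Q j" using LeastI_ex[OF assms[unfolded Bex_def]] unfolding j_def by auto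
  have "\<not> Q k" if "i \<le> k" "k < j" for k
    using not_less_Least[of k "\<lambda>j. i \<le> j \<and> Q j"] that unfolding j_def by blast
  then have "P k" if "i \<le> k" "k < j" for k
    using W that by (metis atLeastAtMost_iff le_less_trans not_le)
  with j show ?U by blast
next
  assume ?U
  then obtain j where j: "j \<ge> i" "Q j" "\<And>k. i \<le> k \<Longrightarrow> k < j \<Longrightarrow> P k" by blast
  then show ?W by (metis atLeastAtMost_iff not_le)
qed

text \<open>If the until-formula holds infinitely often, so does \<open>b\<close>, and the weak
  until is exact. If it fails from \<open>N\<close> on, every witness lies before \<open>N\<close>,
  because \<open>b\<close> at time \<open>j\<close> already makes the until-formula true at
  \<open>j\<close>.\<close>

lemma approx_exact_step:
  assumes "\<forall>i. approx X N w u i a = ltl_holds w i a" "\<forall>i. approx X N w u i b = ltl_holds w i b"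
    and "LUntil a b \<in> X \<Longrightarrow> \<forall>m. \<exists>i\<ge>m. ltl_holds w i (LUntil a b)"
    and "LUntil a b \<notin> X \<Longrightarrow> \<forall>i\<ge>N. \<not> ltl_holds w i (LUntil a b)"
  shows "approx X N w u i (LUntil a b) = ltl_holds w i (LUntil a b)"
proof (cases "u \<and> LUntil a b \<in> X")
  case True
  then have "\<exists>j\<ge>i. ltl_holds w j b" using assms(3) by simp (meson order_trans)
  from weak_until_eq[OF this, of "\<lambda>i. ltl_holds w i a"] show ?thesis using True assms(1,2) by simp
next
  case False
  have "j < N" if "u" "i \<le> j" "ltl_holds w j b" for j
  proof (rule ccontr)
    assume "\<not> j < N"
    moreover have "ltl_holds w j (LUntil a b)"
      unfolding ltl_holds.simps using that(3) by (intro exI[of _ j]) auto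
    ultimately show False using assms(4) False that(1) by (meson not_le)
  qed
  then show ?thesis using False assms(1,2) by auto
qed

text \<open>Only lower approximations are consulted. They are open, so holding infinitely often is a
  G-delta condition and failing from \<open>N\<close> on is a closed one.\<close>

definition good_guess :: "'a ltl set \<Rightarrow> nat \<Rightarrow> (nat \<Rightarrow> 'a \<Rightarrow> bool) \<Rightarrow> 'a ltl \<Rightarrow> bool" where
  "good_guess X N w \<psi> \<longleftrightarrow>
     (\<forall>\<phi>\<in>untils \<psi>. if \<phi> \<in> X then \<forall>m. \<exists>i. i \<ge> m \<and> approx X N w False i \<phi>
                  else \<forall>i\<ge>N. \<not> approx X N w False i \<phi>)"

text \<open>With \<open>a\<close> and \<open>b\<close> exact, the lower clause for until is exact,
  as it does not look at the guess for this formula. So the guess speaks about actual truth, and the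
  upper clause is exact as well.\<close>

lemma good_guess_exact:
  assumes "good_guess X N w \<psi>"
  shows "approx X N w u i \<psi> = ltl_holds w i \<psi>"
  using assms
proof (induction \<psi> arbitrary: u i)
  case (LUntil a b)
  then have ab: "good_guess X N w a" "good_guess X N w b" by (auto simp: good_guess_def)
  have lo: "approx X N w False i (LUntil a b) = ltl_holds w i (LUntil a b)" for i
    using LUntil.IH ab by auto
  have P: "if LUntil a b \<in> X then \<forall>m. \<exists>i. i \<ge> m \<and> ltl_holds w i (LUntil a b)
      else \<forall>i\<ge>N. \<not> ltl_holds w i (LUntil a b)"
  proof -
    have "LUntil a b \<in> untils (LUntil a b)" by simp
    from bspec[OF LUntil.prems[unfolded good_guess_def] this] show ?thesis unfolding lo .
  qed
  then show ?case
  proof (intro approx_exact_step allI)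
    show "approx X N w u i a = ltl_holds w i a" "approx X N w u i b = ltl_holds w i b" for i
      using LUntil.IH ab by blast+
  qed (use P in \<open>auto simp del: ltl_holds.simps split: if_splits\<close>)
qed (auto simp: good_guess_def)

text \<open>\<open>X\<close> is read off from \<open>w\<close>. One \<open>N\<close> serves all
  remaining until-subformulas because there are finitely many.\<close>

lemma good_guess_exists: "\<exists>X\<subseteq>untils \<psi>. \<exists>N. good_guess X N w \<psi>"
proof -
  define X where "X = {\<phi>\<in>untils \<psi>. \<forall>m. \<exists>i\<ge>m. ltl_holds w i \<phi>}"
  have "\<forall>\<phi>\<in>untils \<psi> - X. \<exists>m. \<forall>i\<ge>m. \<not> ltl_holds w i \<phi>" unfolding X_def by auto
  then obtain f where f: "\<And>\<phi> i. \<phi> \<in> untils \<psi> - X \<Longrightarrow> i \<ge> f \<phi> \<Longrightarrow> \<not> ltl_holds w i \<phi>" by metis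
  obtain N where "\<forall>m\<in>f ` (untils \<psi> - X). m \<le> N"
    using finite_untils finite_nat_set_iff_bounded_le by (metis finite_Diff finite_imageI)
  then have N: "\<not> ltl_holds w i \<phi>" if "\<phi> \<in> untils \<psi>" "\<phi> \<notin> X" "i \<ge> N" for \<phi> i
    using f[of \<phi> i] that by (meson Diff_iff image_eqI order_trans)
  have ex: "approx X N w u i \<phi> = ltl_holds w i \<phi>" if "untils \<phi> \<subseteq> untils \<psi>" for u i \<phi>
    using that
  proof (induction \<phi> arbitrary: u i)
    case (LUntil a b)
    then show ?case
      using N[of "LUntil a b"] by (intro approx_exact_step) (auto simp: X_def)
  qed auto
  have sub: "\<phi>' \<in> untils \<phi> \<Longrightarrow> untils \<phi>' \<subseteq> untils \<phi>" for \<phi> \<phi>' :: "'a ltl"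
    by (induction \<phi>) auto
  have "good_guess X N w \<psi>"
    unfolding good_guess_def
  proof
    fix \<phi> assume \<phi>: "\<phi> \<in> untils \<psi>"
    then have "\<phi> \<in> X \<Longrightarrow> \<forall>m. \<exists>i\<ge>m. ltl_holds w i \<phi>" by (simp add: X_def)
    then show "if \<phi> \<in> X then \<forall>m. \<exists>i\<ge>m. approx X N w False i \<phi>
        else \<forall>i\<ge>N. \<not> approx X N w False i \<phi>"
      unfolding ex[OF sub[OF \<phi>]] using N[OF \<phi>] by simp
  qed
  moreover have "X \<subseteq> untils \<psi>" unfolding X_def by blast
  ultimately show ?thesis by blast
qed

text \<open>Comparing with \<open>u\<close> states both halves at once: the lower approximation is
  open, and so is the complement of the upper one. Negation exchanges them, hence the joint
  induction.\<close>

lemma approx_open: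
  assumes "\<And>i p c. open_pred (\<lambda>x. w x i p = c)"
  shows "open_pred (\<lambda>x. approx X N (w x) u i \<psi> \<noteq> u)"
proof (induction \<psi> arbitrary: u i)
  case (LProp p)
  show ?case using assms[of i p "\<not> u"] by (simp add: eq_commute[of u])
next
  case (LNot a)
  show ?case using LNot[of "\<not> u" i] by simp
next
  case (LAnd a b)
  show ?case
  proof (cases u)
    case True
    then have "open_pred (\<lambda>x. \<not> approx X N (w x) True i a \<or> \<not> approx X N (w x) True i b)"
      using LAnd.IH[of True i] by (intro open_pred_disj) auto
    then show ?thesis using True by simp
  next
    case False
    then have "open_pred (\<lambda>x. approx X N (w x) False i a \<and> approx X N (w x) False i b)"
      using LAnd.IH[of False i] by (intro open_pred_conj) auto
    then show ?thesis using False by simp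
  qed
next
  case (LUntil a b)
  have IH: "open_pred (\<lambda>x. \<not> approx X N (w x) True i a)" "open_pred (\<lambda>x. approx X N (w x) False i a)"
    "open_pred (\<lambda>x. \<not> approx X N (w x) True i b)" "open_pred (\<lambda>x. approx X N (w x) False i b)" for i
    using LUntil.IH[of True i] LUntil.IH[of False i] by auto
  show ?case
  proof (cases u)
    case False
    then show ?thesis
      by simp (intro open_pred_ex open_pred_conj open_pred_ball open_pred_const IH finite_atLeastLessThan)
  next
    case True
    show ?thesis
    proof (cases "LUntil a b \<in> X")
      case t: True
      have "open_pred (\<lambda>x. \<exists>j. \<not> j < i \<and> \<not> approx X N (w x) True j a \<and> (\<forall>k\<in>{i..j}. \<not> approx X N (w x) True k b))"
        by (intro open_pred_ex open_pred_conj open_pred_ball open_pred_const IH finite_atLeastAtMost)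
      then show ?thesis using True t by simp
    next
      case f: False
      have "open_pred (\<lambda>x. \<forall>j\<in>{i..<N}. \<not> approx X N (w x) True j b \<or> (\<exists>k. k\<in>{i..<j} \<and> \<not> approx X N (w x) True k a))"
        by (intro open_pred_ex open_pred_conj open_pred_disj open_pred_ball open_pred_const IH finite_atLeastLessThan)
      moreover have "(\<lambda>x. \<forall>j\<in>{i..<N}. \<not> approx X N (w x) True j b \<or> (\<exists>k. k\<in>{i..<j} \<and> \<not> approx X N (w x) True k a)) =
        (\<lambda>x. approx X N (w x) u i (LUntil a b) \<noteq> u)"
        using True f by (auto simp: fun_eq_iff Bex_def Ball_def)
      ultimately show ?thesis by simp
    qed
  qed
qed (auto intro: open_pred_const)

theorem ltl_sigma3:
  assumes w: "\<And>i p c. open_pred (\<lambda>x. w x i p = c)"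
  obtains D where "\<And>x. ltl_holds (w x) 0 \<psi> \<longleftrightarrow> (\<exists>n::nat. infinite {k. pre x k \<in> D n})"
proof -
  define C where "C = (\<lambda>(X, N) x. good_guess X N (w x) \<psi> \<and> approx X N (w x) False 0 \<psi>)"
  define I where "I = Pow (untils \<psi>) \<times> (UNIV :: nat set)"
  have "countable I" "I \<noteq> {}"
    unfolding I_def by (simp_all add: countable_finite finite_untils Pow_not_empty)
  then obtain e :: "nat \<Rightarrow> _" where e: "range e = I" by (metis range_from_nat_into)
  have gd: "gdelta (C c)" for c
  proof -
    obtain X N where c: "c = (X, N)" by (cases c)
    have lo: "open_pred (\<lambda>x. approx X N (w x) False i \<phi>)" for i \<phi>
      using approx_open[of w X N False i \<phi>, OF w] by simp
    have "gdelta (\<lambda>x. (\<forall>\<phi>\<in>untils \<psi>. if \<phi> \<in> X then \<forall>m. \<exists>i. i \<ge> m \<and> approx X N (w x) False i \<phi>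
                  else \<forall>i. i \<ge> N \<longrightarrow> \<not> approx X N (w x) False i \<phi>) \<and> approx X N (w x) False 0 \<psi>)"
    proof (intro gdelta_conj gdelta_ball finite_untils gdelta_open[OF lo])
      fix \<phi>
      show "gdelta (\<lambda>x. if \<phi> \<in> X then \<forall>m. \<exists>i. i \<ge> m \<and> approx X N (w x) False i \<phi>
          else \<forall>i. i \<ge> N \<longrightarrow> \<not> approx X N (w x) False i \<phi>)"
      proof (cases "\<phi> \<in> X")
        case True
        then show ?thesis
          by simp (intro gdelta_all gdelta_open open_pred_ex open_pred_conj open_pred_const lo)
      next
        case False
        have "gdelta (\<lambda>x. N \<le> i \<longrightarrow> \<not> approx X N (w x) False i \<phi>)" for i
          by (intro gdelta_closed, simp) (intro open_pred_conj open_pred_const lo)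
        then show ?thesis using False by simp (rule gdelta_all)
      qed
    qed
    then show ?thesis unfolding c C_def good_guess_def by simp
  qed
  have "\<exists>D. \<forall>x. C c x \<longleftrightarrow> infinite {k. pre x k \<in> D}" for c
    using gdelta_infinitely_often[OF gd] by metis
  then obtain D where D: "\<And>c x. C c x \<longleftrightarrow> infinite {k. pre x k \<in> D c}" by metis
  have "ltl_holds (w x) 0 \<psi> \<longleftrightarrow> (\<exists>n. infinite {k. pre x k \<in> D (e n)})" for x
  proof -
    have "ltl_holds (w x) 0 \<psi> \<longleftrightarrow> (\<exists>c\<in>I. C c x)"
      using good_guess_exists[of \<psi> "w x"] good_guess_exact unfolding C_def I_def by fastforce
    then show ?thesis unfolding e[symmetric] D by simp
  qed
  then show ?thesis by (rule that)
qed

section \<open>Strategies and the hyperassignment semantics\<close>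

lemma hap_HAsg: "X \<in> HAsg P \<Longrightarrow> hap X = P"
proof -
  assume X: "X \<in> HAsg P"
  then obtain Y where "Y \<in> X" "Y \<noteq> {}" unfolding HAsg_def by blast
  then have "\<exists>\<chi>. \<exists>Y\<in>X. \<chi> \<in> Y" by blast
  then have "\<exists>Y\<in>X. (SOME \<chi>. \<exists>Y\<in>X. \<chi> \<in> Y) \<in> Y" by (rule someI_ex)
  then show ?thesis using X unfolding hap_def HAsg_def Asg_def by auto
qed

lemma dual_HAsg: "X \<in> HAsg P \<Longrightarrow> dual X \<in> HAsg P"
proof -
  assume X: "X \<in> HAsg P"
  then have "\<forall>Y\<in>X. (SOME \<chi>. \<chi> \<in> Y) \<in> Y" unfolding HAsg_def by (metis (mono_tags, lifting) all_not_in_conv mem_Collect_eq someI_ex)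
  then have "(\<lambda>Y. SOME \<chi>. \<chi> \<in> Y) ` X \<in> dual X" unfolding dual_def by blast
  then have "dual X \<noteq> {}" by blast
  then show ?thesis using X unfolding HAsg_def dual_def by auto
qed

lemma ext_spec_B_HAsg:
  assumes "X \<in> HAsg P"
  shows "ext_spec spec_B X p \<in> HAsg (insert p P)"
proof -
  have "(\<lambda>_ _. False) \<in> Fnc_spec spec_B (hap X)"
    by (auto simp: Fnc_spec_def spec_B_def behavioral_def)
  then have "ext_spec spec_B X p \<noteq> {}" using assms unfolding ext_spec_def HAsg_def by blast
  moreover have "ext_asg \<chi> F p \<in> Asg (insert p P)" if "Y \<in> X" "\<chi> \<in> Y" for \<chi> Y F
    using assms that unfolding HAsg_def Asg_def ext_asg_def by auto
  ultimately show ?thesis using assms unfolding HAsg_def ext_spec_def by auto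
qed

text \<open>Being behavioral restricts the dependence on one proposition at a time. Turning
  \<open>\<chi>1\<close> into \<open>\<chi>2\<close> proposition by proposition, in finitely many
  steps, gives joint causality.\<close>

lemma behavioral_jointly_causal:
  assumes F: "F \<in> Fnc_spec spec_B P" and "finite P" and "\<chi>1 \<in> Asg P" "\<chi>2 \<in> Asg P"
    and eq: "\<And>q u. q \<in> P \<Longrightarrow> u \<le> t \<Longrightarrow> the (\<chi>1 q) u = the (\<chi>2 q) u"
  shows "F \<chi>1 t = F \<chi>2 t"
proof -
  define mix where "mix S q = (if q \<in> S then \<chi>2 q else \<chi>1 q)" for S q
  have mixA: "mix S \<in> Asg P" for S
    using assms(3,4) by (auto simp: mix_def Asg_def dom_def split: if_splits)
  have "F \<chi>1 t = F (mix S) t" if "finite S" "S \<subseteq> P" for S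
    using that
  proof (induction S rule: finite_induct)
    case empty
    have "mix {} = \<chi>1" by (simp add: mix_def fun_eq_iff)
    then show ?case by simp
  next
    case (insert q S)
    have "agree_gt P q t (mix S) (mix (insert q S))"
      using insert eq unfolding agree_gt_def mix_def by auto
    moreover have "behavioral P F q" using F insert.prems by (simp add: Fnc_spec_def spec_B_def)
    ultimately have "F (mix S) t = F (mix (insert q S)) t"
      using mixA unfolding behavioral_def by blast
    with insert show ?case by simp
  qed
  from this[OF \<open>finite P\<close> order_refl] have "F \<chi>1 t = F (mix P) t" .
  moreover have "mix P = \<chi>2" using assms(3,4) by (auto simp: mix_def Asg_def fun_eq_iff)
  ultimately show ?thesis by simp
qed

text \<open>The play in which every move is computed by \<open>f\<close> from the preceding
  moves.\<close>

function outcome :: "('m list \<Rightarrow> 'm) \<Rightarrow> nat \<Rightarrow> 'm" where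
  "outcome f m = f (map (outcome f) [0..<m])"
  by auto
termination by (relation "measure snd") auto

declare outcome.simps [simp del]

text \<open>The flag under which the quantifier extends the hyperassignment directly, without
  passing to the dual.\<close>

fun flag_of :: "quant \<Rightarrow> flag" where
  "flag_of QEx = EA" | "flag_of QAll = AE"

text \<open>A play is a Boolean sequence read in rounds of length \<open>Suc n\<close>: move \<open>j < n\<close> of round \<open>t\<close> is the
  value of the \<open>j\<close>-th quantified proposition at time \<open>t\<close>, and move \<open>n\<close>, which corresponds to the
  return to the empty valuation, is a dummy.\<close>
locale quantifier_prefix =
  fixes qs :: "(quant \<times> 'a) list"
  assumes distinct: "distinct (map snd qs)"
begin

abbreviation n :: nat where "n \<equiv> length qs"
abbreviation qvar :: "nat \<Rightarrow> 'a" where "qvar j \<equiv> snd (qs ! j)"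
abbreviation idx :: "nat \<Rightarrow> nat" where "idx m \<equiv> m mod Suc n"
abbreviation props :: "nat \<Rightarrow> 'a set" where "props i \<equiv> set (take i (map snd qs))"

definition owns :: "quant \<Rightarrow> nat \<Rightarrow> bool" where
  "owns Q m \<longleftrightarrow> idx m < n \<and> fst (qs ! idx m) = Q"

definition letters :: "(nat \<Rightarrow> bool) \<Rightarrow> nat \<Rightarrow> 'a \<Rightarrow> bool" where
  "letters b t p \<longleftrightarrow> (\<exists>j<n. qvar j = p \<and> b (t * Suc n + j))"

definition asg_of :: "(nat \<Rightarrow> bool) \<Rightarrow> nat \<Rightarrow> 'a asg" where
  "asg_of b i = (\<lambda>p. if p \<in> props i then Some (\<lambda>t. letters b t p) else None)"

definition obeys :: "quant \<Rightarrow> (bool list \<Rightarrow> bool) \<Rightarrow> (nat \<Rightarrow> bool) \<Rightarrow> bool" where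
  "obeys Q s b \<longleftrightarrow> (\<forall>m. idx m = n \<longrightarrow> \<not> b m) \<and> (\<forall>m. owns Q m \<longrightarrow> b m = s (pre b m))"

text \<open>Opponent moves of index below \<open>i\<close> are not tied to \<open>\<tau>\<close>:
  their propositions are already quantified and their values belong to the assignment.\<close>

definition completes :: "quant \<Rightarrow> (bool list \<Rightarrow> bool) \<Rightarrow> nat \<Rightarrow> (bool list \<Rightarrow> bool) \<Rightarrow> (nat \<Rightarrow> bool) \<Rightarrow> bool" where
  "completes Q s i \<tau> b \<longleftrightarrow> obeys Q s b \<and>
     (\<forall>m. i \<le> idx m \<and> idx m < n \<and> \<not> owns Q m \<longrightarrow> b m = \<tau> (pre b m))"

definition completable :: "quant \<Rightarrow> (bool list \<Rightarrow> bool) \<Rightarrow> nat \<Rightarrow> (bool list \<Rightarrow> bool) \<Rightarrow> 'a asg \<Rightarrow> bool" where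
  "completable Q s i \<tau> \<chi> \<longleftrightarrow> (\<exists>b. completes Q s i \<tau> b \<and> \<chi> = asg_of b i)"

text \<open>Invariant of the evaluation of the quantifier prefix when player \<open>Q\<close> uses the strategy \<open>s\<close>: it is
  relative to all possible future behaviours \<open>\<tau>\<close> of the opponent, because the hyperassignment
  semantics lets a player's earlier choices depend on them.\<close>
definition good :: "quant \<Rightarrow> (bool list \<Rightarrow> bool) \<Rightarrow> flag \<Rightarrow> nat \<Rightarrow> 'a hasg \<Rightarrow> bool" where
  "good Q s \<alpha> i X \<longleftrightarrow>
     (if \<alpha> = flag_of Q then \<forall>\<tau>. \<exists>Y\<in>X. \<forall>\<chi>\<in>Y. completable Q s i \<tau> \<chi>
      else \<forall>\<tau>. \<forall>Y\<in>X. \<exists>\<chi>\<in>Y. completable Q s i \<tau> \<chi>)"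

lemma qvar_inject: "i < n \<Longrightarrow> j < n \<Longrightarrow> qvar i = qvar j \<longleftrightarrow> i = j"
  using distinct nth_eq_iff_index_eq[of "map snd qs" i j] by simp

lemma in_props: "p \<in> props i \<longleftrightarrow> (\<exists>j. j < i \<and> j < n \<and> p = qvar j)"
  by (auto simp: in_set_conv_nth)

lemma props_Suc: "i < n \<Longrightarrow> props (Suc i) = insert (qvar i) (props i)"
  by (auto simp: take_Suc_conv_app_nth)

lemma finite_props: "finite (props i)" by simp

lemma letters_qvar: "j < n \<Longrightarrow> letters b t (qvar j) = b (t * Suc n + j)"
  unfolding letters_def using qvar_inject by auto

lemma pos_mod: "j \<le> n \<Longrightarrow> idx (t * Suc n + j) = j"
  by (metis le_imp_less_Suc mod_less mod_mult_self3)

lemma pos_div: "j \<le> n \<Longrightarrow> (t * Suc n + j) div Suc n = t"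
  by (metis add.commute add.right_neutral div_less div_mult_self1 le_imp_less_Suc nat.distinct(1))

lemma pos_collapse: "m div Suc n * Suc n + idx m = m"
  by (rule div_mult_mod_eq)

lemma asg_of_Asg: "asg_of b i \<in> Asg (props i)"
  by (auto simp: asg_of_def Asg_def dom_def)

section \<open>Preservation of the invariant along the quantifier prefix\<close>

lemma good_dual: "good Q s \<alpha> i X \<Longrightarrow> good Q s (flip \<alpha>) i (dual X)"
proof (cases "\<alpha> = flag_of Q")
  case True
  assume "good Q s \<alpha> i X"
  then show ?thesis using True unfolding good_def dual_def by (cases \<alpha>) fastforce+
next
  case False
  assume g: "good Q s \<alpha> i X"
  have fl: "flip \<alpha> = flag_of Q" using False by (cases \<alpha>; cases Q) auto
  have "\<exists>Z\<in>dual X. \<forall>\<chi>\<in>Z. completable Q s i \<tau> \<chi>" for \<tau>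
  proof -
    from g False have "\<forall>Y\<in>X. \<exists>\<chi>. \<chi> \<in> Y \<and> completable Q s i \<tau> \<chi>" unfolding good_def by auto
    then obtain c where "\<forall>Y\<in>X. c Y \<in> Y \<and> completable Q s i \<tau> (c Y)" by metis
    then show ?thesis unfolding dual_def by (intro bexI[of _ "c ` X"]) auto
  qed
  then show ?thesis unfolding good_def fl by simp
qed

text \<open>The functor may depend on \<open>\<tau>\<close>, since the invariant asks for a set
  \<open>Y\<close> for each \<open>\<tau>\<close> separately. It simulates \<open>s\<close> against
  \<open>\<tau>\<close>, reading the earlier propositions from \<open>\<chi>\<close>.\<close>

lemma good_ext_own:
  assumes i: "i < n" and Q: "fst (qs ! i) = Q" and X: "X \<in> HAsg (props i)"
    and good: "good Q s (flag_of Q) i X"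
  shows "good Q s (flag_of Q) (Suc i) (ext_spec spec_B X (qvar i))"
proof -
  have "\<exists>Y\<in>ext_spec spec_B X (qvar i). \<forall>\<chi>\<in>Y. completable Q s (Suc i) \<tau> \<chi>" for \<tau>
  proof -
    have "\<exists>Y\<in>X. \<forall>\<chi>\<in>Y. completable Q s i \<tau> \<chi>" using good by (simp add: good_def)
    then obtain Y where Y: "Y \<in> X" "\<And>\<chi>. \<chi> \<in> Y \<Longrightarrow> completable Q s i \<tau> \<chi>" by blast
    define f where "f \<chi> l = (let m = length l in if idx m = n then False
      else if idx m < i then the (\<chi> (qvar (idx m))) (m div Suc n)
      else if owns Q m then s l else \<tau> l)" for \<chi> :: "'a asg" and l
    define F where "F \<chi> t = outcome (f \<chi>) (t * Suc n + i)" for \<chi> t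
    \<comment> \<open>The simulation reproduces any \<open>b\<close> that completes
      \<open>\<chi>\<close>, so the same \<open>b\<close> witnesses the extended assignment.\<close>
    have unique: "outcome (f \<chi>) m = b m" if b: "completes Q s i \<tau> b" "\<chi> = asg_of b i" for \<chi> b m
    proof (induction m rule: less_induct)
      case (less m)
      then have "map (outcome (f \<chi>)) [0..<m] = pre b m" by simp
      then have "outcome (f \<chi>) m = f \<chi> (pre b m)" by (subst outcome.simps) (simp del: map_eq_conv)
      also have "\<dots> = b m"
      proof (cases "idx m < i")
        case True
        then have "the (\<chi> (qvar (idx m))) (m div Suc n) = b m"
        proof -
          have "qvar (idx m) \<in> props i" "idx m < n" using True i by (auto simp: in_props)
          then show ?thesis
            unfolding b(2) asg_of_def by (simp only: if_True option.sel letters_qvar pos_collapse)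
        qed
        then show ?thesis using True i by (simp add: f_def)
      next
        case False
        moreover have "idx m \<noteq> n \<Longrightarrow> idx m < n" using mod_less_divisor[of "Suc n" m] by linarith
        ultimately show ?thesis using b(1) unfolding completes_def obeys_def f_def by auto
      qed
      finally show ?case .
    qed
    \<comment> \<open>Moves up to index \<open>i\<close> of round \<open>k\<close> read
      \<open>\<chi>\<close> only at times up to \<open>k\<close>; this makes \<open>F\<close>
      behavioral.\<close>
    have causal: "outcome (f \<chi>1) m = outcome (f \<chi>2) m"
      if agree: "agree_gt (props i) q k \<chi>1 \<chi>2" and m: "m \<le> k * Suc n + i" for \<chi>1 \<chi>2 q k m
      using m
    proof (induction m rule: less_induct)
      case (less m)
      then have eq: "map (outcome (f \<chi>1)) [0..<m] = map (outcome (f \<chi>2)) [0..<m]" by simp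
      have "m div Suc n \<le> k" using less.prems pos_div[of i k] i by (metis div_le_mono less_imp_le)
      moreover have "qvar (idx m) \<in> props i" if "idx m < i" using that i in_props by auto
      ultimately have "idx m < i \<Longrightarrow>
          the (\<chi>1 (qvar (idx m))) (m div Suc n) = the (\<chi>2 (qvar (idx m))) (m div Suc n)"
        using agree unfolding agree_gt_def by (cases "qvar (idx m) = q") auto
      then show ?case
        by (subst (1 2) outcome.simps) (simp add: eq f_def del: map_eq_conv)
    qed
    have "F \<in> Fnc_spec spec_B (hap X)"
      unfolding hap_HAsg[OF X] Fnc_spec_def spec_B_def behavioral_def F_def using causal by auto
    then have "(\<lambda>\<chi>. ext_asg \<chi> F (qvar i)) ` Y \<in> ext_spec spec_B X (qvar i)"
      using Y(1) unfolding ext_spec_def by blast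
    moreover have "completable Q s (Suc i) \<tau> (ext_asg \<chi> F (qvar i))" if "\<chi> \<in> Y" for \<chi>
    proof -
      obtain b where b: "completes Q s i \<tau> b" "\<chi> = asg_of b i"
        using Y(2)[OF \<open>\<chi> \<in> Y\<close>] unfolding completable_def by blast
      have "F \<chi> = (\<lambda>t. letters b t (qvar i))"
        using i by (simp add: F_def unique[OF b] letters_qvar fun_eq_iff)
      then have "ext_asg \<chi> F (qvar i) = asg_of b (Suc i)"
        using i by (auto simp: ext_asg_def b(2) asg_of_def props_Suc fun_eq_iff)
      moreover have "completes Q s (Suc i) \<tau> b" using b(1) by (auto simp: completes_def)
      ultimately show ?thesis unfolding completable_def by blast
    qed
    ultimately show ?thesis
      by (intro bexI[of _ "(\<lambda>\<chi>. ext_asg \<chi> F (qvar i)) ` Y"]) auto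
  qed
  then show ?thesis by (simp add: good_def)
qed

text \<open>The opponent's functor is absorbed into the behaviour \<open>\<tau>'\<close>, so the
  invariant at \<open>i\<close> for \<open>\<tau>'\<close> gives the one at \<open>Suc i\<close> for
  \<open>\<tau>\<close>.\<close>

lemma good_ext_opponent:
  assumes i: "i < n" and R: "fst (qs ! i) = R" "R \<noteq> Q" and X: "X \<in> HAsg (props i)"
    and good: "good Q s (flag_of R) i X"
  shows "good Q s (flag_of R) (Suc i) (ext_spec spec_B X (qvar i))"
proof -
  have fl: "flag_of R \<noteq> flag_of Q" using R(2) by (cases R; cases Q) auto
  have "\<exists>\<chi>\<in>Y. completable Q s (Suc i) \<tau> \<chi>" if Y: "Y \<in> ext_spec spec_B X (qvar i)" for \<tau> Y
  proof -
    obtain Y' F where Y': "Y' \<in> X" "Y = (\<lambda>\<chi>. ext_asg \<chi> F (qvar i)) ` Y'" "F \<in> Fnc_spec spec_B (props i)"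
      using Y unfolding ext_spec_def hap_HAsg[OF X] by blast
    \<comment> \<open>Bits beyond the history are padded with \<open>False\<close>. By joint
      causality \<open>F\<close> at this time depends only on bits already in
      \<open>l\<close>.\<close>
    define \<tau>' where "\<tau>' l = (if idx (length l) = i
      then F (asg_of (\<lambda>m. m < length l \<and> l ! m) i) (length l div Suc n) else \<tau> l)" for l
    obtain \<chi> b where \<chi>: "\<chi> \<in> Y'" and b: "completes Q s i \<tau>' b" "\<chi> = asg_of b i"
      using good fl Y'(1) unfolding good_def completable_def by (metis (full_types))
    have "F \<chi> t = letters b t (qvar i)" for t
    proof -
      define m where "m = t * Suc n + i"
      have m: "idx m = i" "m div Suc n = t" using i by (simp_all add: m_def pos_mod pos_div del: mult_Suc_right)
      have "\<not> owns Q m" using R m by (simp add: owns_def)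
      then have "b m = \<tau>' (pre b m)" using b(1) m i unfolding completes_def by simp
      also have "\<dots> = F (asg_of (\<lambda>k. k < m \<and> pre b m ! k) i) t" using m by (simp add: \<tau>'_def)
      also have "\<dots> = F \<chi> t"
        unfolding b(2)
      proof (rule behavioral_jointly_causal[OF Y'(3) finite_props asg_of_Asg asg_of_Asg])
        fix q u assume q: "q \<in> props i" and u: "u \<le> t"
        then obtain j where j: "j < i" "j < n" "q = qvar j" by (auto simp: in_props)
        have "u * Suc n + j < m" unfolding m_def using u j(1) by (intro add_le_less_mono mult_le_mono1)
        then show "the (asg_of (\<lambda>k. k < m \<and> pre b m ! k) i q) u = the (asg_of b i q) u"
          using q j by (simp add: asg_of_def letters_qvar del: mult_Suc_right)
      qed
      finally show ?thesis using i by (simp add: letters_qvar m_def)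
    qed
    then have "ext_asg \<chi> F (qvar i) = asg_of b (Suc i)"
      using i by (auto simp: ext_asg_def b(2) asg_of_def props_Suc fun_eq_iff)
    moreover have "completes Q s (Suc i) \<tau> b"
      using b(1) unfolding completes_def \<tau>'_def by auto
    ultimately show ?thesis using \<chi> Y'(2) unfolding completable_def by blast
  qed
  then show ?thesis using fl by (simp add: good_def)
qed

lemma good_sem:
  assumes wins: "\<And>b. obeys Q s b \<Longrightarrow> ltl_holds (letters b) 0 \<psi> \<longleftrightarrow> Q = QEx"
    and "i \<le> n" "X \<in> HAsg (props i)" "good Q s \<alpha> i X"
  shows "sem (behav_formula (drop i qs) \<psi>) \<alpha> X \<longleftrightarrow> Q = QEx"
  using assms(2-4)
proof (induction i arbitrary: \<alpha> X rule: inc_induct)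
  case base
  have c: "ltl_models \<chi> \<psi> \<longleftrightarrow> Q = QEx" if ch: "completable Q s n \<tau> \<chi>" for \<chi> \<tau>
  proof -
    obtain b where b: "obeys Q s b" "\<chi> = asg_of b n"
      using ch by (auto simp: completable_def completes_def)
    have "asg_letters \<chi> = letters b"
      by (auto simp: fun_eq_iff asg_letters_def b(2) asg_of_def letters_def)
    then show ?thesis using wins[OF b(1)] by (simp add: ltl_models_def)
  qed
  have "if \<alpha> = flag_of Q then \<exists>Y\<in>X. \<forall>\<chi>\<in>Y. ltl_models \<chi> \<psi> \<longleftrightarrow> Q = QEx
      else \<forall>Y\<in>X. \<exists>\<chi>\<in>Y. ltl_models \<chi> \<psi> \<longleftrightarrow> Q = QEx"
  proof (cases "\<alpha> = flag_of Q")
    case True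
    then have "\<forall>\<tau>. \<exists>Y\<in>X. \<forall>\<chi>\<in>Y. completable Q s n \<tau> \<chi>" using base(2) by (simp only: good_def if_True simp_thms)
    \<comment> \<open>No index is both at least \<open>n\<close> and below \<open>n\<close>, so at
      this level \<open>\<tau>\<close> constrains nothing and any value will do.\<close>
    then have "\<exists>Y\<in>X. \<forall>\<chi>\<in>Y. completable Q s n undefined \<chi>" ..
    then show ?thesis unfolding if_P[OF True] using c by meson
  next
    case False
    then have "\<forall>\<tau>. \<forall>Y\<in>X. \<exists>\<chi>\<in>Y. completable Q s n \<tau> \<chi>" using base(2) by (simp only: good_def if_False)
    then have "\<forall>Y\<in>X. \<exists>\<chi>\<in>Y. completable Q s n undefined \<chi>" ..
    then show ?thesis unfolding if_not_P[OF False] using c by meson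
  qed
  then show ?case by (cases Q; cases \<alpha>) (simp_all add: behav_formula_def)
next
  case (step i)
  define R where "R = fst (qs ! i)"
  define Z where "Z = (if \<alpha> = flag_of R then X else dual X)"
  have "drop i qs = (R, qvar i) # drop (Suc i) qs"
    using Cons_nth_drop_Suc[OF step.hyps(2)] by (simp add: R_def)
  then have "sem (behav_formula (drop i qs) \<psi>) \<alpha> X =
      sem (behav_formula (drop (Suc i) qs) \<psi>) (flag_of R) (ext_spec spec_B Z (qvar i))"
    by (cases R; cases \<alpha>) (simp_all add: behav_formula_def Z_def)
  moreover have Z: "Z \<in> HAsg (props i)" using step.prems dual_HAsg unfolding Z_def by auto
  moreover have gZ: "good Q s (flag_of R) i Z"
  proof (cases "\<alpha> = flag_of R")
    case True
    then show ?thesis using step.prems by (simp add: Z_def)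
  next
    case False
    then have "flip \<alpha> = flag_of R" by (cases \<alpha>; cases R) auto
    then show ?thesis using good_dual[OF step.prems(2)] False by (simp add: Z_def)
  qed
  moreover have "good Q s (flag_of R) (Suc i) (ext_spec spec_B Z (qvar i))"
  proof (cases "R = Q")
    case True
    then show ?thesis using good_ext_own[OF step.hyps(2) _ Z, of Q s] R_def gZ by simp
  next
    case False
    then show ?thesis using good_ext_opponent[OF step.hyps(2) _ _ Z, of R Q s] R_def gZ by simp
  qed
  moreover have "ext_spec spec_B Z (qvar i) \<in> HAsg (props (Suc i))"
    using ext_spec_B_HAsg[OF Z] step.hyps by (simp only: props_Suc)
  ultimately show ?case using step.IH by simp
qed

text \<open>\<open>s\<close> and \<open>\<tau>\<close> together determine a full sequence, and its
  assignment at level 0 is empty.\<close>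

lemma good_initial: "good Q s \<alpha> 0 {{Map.empty}}"
proof -
  have "completable Q s 0 \<tau> Map.empty" for \<tau>
  proof -
    define f where "f l = (if idx (length l) = n then False
      else if owns Q (length l) then s l else \<tau> l)" for l
    have "outcome f m = f (pre (outcome f) m)" for m by (rule outcome.simps)
    then have "completes Q s 0 \<tau> (outcome f)"
      unfolding completes_def obeys_def f_def by (auto simp: owns_def)
    then show ?thesis unfolding completable_def by (intro exI[of _ "outcome f"]) (simp add: asg_of_def)
  qed
  then show ?thesis by (simp add: good_def)
qed

theorem strategy_satisfiable:
  assumes "\<And>b. obeys Q s b \<Longrightarrow> ltl_holds (letters b) 0 \<psi> \<longleftrightarrow> Q = QEx"
    and "ltl_props \<psi> \<subseteq> set (map snd qs)"
  shows "satisfiable (behav_formula qs \<psi>) \<longleftrightarrow> Q = QEx"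
proof -
  have "gfree (behav_formula xs \<psi>) = ltl_props \<psi> - snd ` set xs" for xs :: "(quant \<times> 'a) list"
    by (induction xs) (auto simp: behav_formula_def split: if_splits)
  then have free: "gfree (behav_formula qs \<psi>) = {}" using assms(2) by auto
  \<comment> \<open>A sentence is evaluated at a single possible hyperassignment, so satisfiability
    is truth there under both flags.\<close>
  have "X = {{Map.empty}} \<longleftrightarrow> X \<in> HAsg {}" for X :: "'a hasg"
    by (auto simp: HAsg_def Asg_def subset_singleton_iff)
  then have H: "HAsg {} = {{{Map.empty :: 'a asg}}}" by blast
  have "sem (behav_formula (drop 0 qs) \<psi>) \<alpha> {{Map.empty}} \<longleftrightarrow> Q = QEx" for \<alpha>
    by (intro good_sem[OF assms(1)] good_initial) (auto simp: H)
  then show ?thesis by (simp add: satisfiable_def flag_satisfiable_def free H)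
qed

end

section \<open>Strategies in the quantification game\<close>

lemma play_hist_eq: "play_hist G sE sA k = pre (play G sE sA) (Suc k)"
proof (induction k)
  case 0
  show ?case by (simp add: play_def)
next
  case (Suc k)
  have "play_hist G sE sA (Suc k) = play_hist G sE sA k @ [play G sE sA (Suc k)]"
    by (simp add: play_def Let_def)
  then show ?case using Suc by (simp del: play_hist.simps)
qed

lemma is_history_play:
  assumes sE: "is_strategy G (posE G) sE" and sA: "is_strategy G (posA G) sA"
    and pos: "\<And>h. is_history G h \<Longrightarrow> last h \<in> posE G \<union> posA G"
  shows "is_history G (play_hist G sE sA k)"
proof (induction k)
  case 0
  show ?case by (simp add: is_history_def)
next
  case (Suc k)
  define h where "h = play_hist G sE sA k"
  have h: "is_history G h" using Suc by (simp add: h_def)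
  define v where "v = (if last h \<in> posE G then sE h else sA h)"
  have "(last h, v) \<in> moves G"
    using h pos[OF h] sE sA unfolding v_def is_strategy_def by auto
  moreover have "play_hist G sE sA (Suc k) = h @ [v]" by (simp add: h_def v_def Let_def)
  moreover have "h \<noteq> []" using h by (simp add: is_history_def)
  ultimately show ?case
    using h unfolding is_history_def by (auto simp: nth_append last_conv_nth less_Suc_eq dest: less_SucE)
     (metis One_nat_def Suc_lessI diff_Suc_Suc diff_zero)
qed

lemma word_inject: "word \<chi>1 = word \<chi>2 \<Longrightarrow> \<chi>1 = \<chi>2"
proof
  fix p assume "word \<chi>1 = word \<chi>2"
  then have "map_option (\<lambda>f. f t) (\<chi>1 p) = map_option (\<lambda>f. f t) (\<chi>2 p)" for t
    unfolding word_def by metis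
  then show "\<chi>1 p = \<chi>2 p" by (cases "\<chi>1 p"; cases "\<chi>2 p") (auto simp: fun_eq_iff)
qed

lemma enumerate_strict_mono_range:
  assumes "strict_mono (f :: nat \<Rightarrow> nat)"
  shows "enumerate (range f) k = f k"
proof (induction k)
  case 0
  show ?case
    unfolding enumerate_0 using assms
    by (intro Least_equality) (auto simp: strict_mono_less_eq)
next
  case (Suc k)
  have "infinite (range f)" using assms by (simp add: range_inj_infinite strict_mono_imp_inj_on)
  then show ?case
    unfolding enumerate_Suc''[OF \<open>infinite (range f)\<close>] Suc using assms
    by (intro Least_equality) (auto simp: strict_mono_less strict_mono_less_eq)
qed

section \<open>Translation between Boolean sequences and plays of the quantification game\<close>

context quantifier_prefix
begin

text \<open>A history of \<open>m + 1\<close> positions records \<open>m\<close> bits: bit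
  \<open>k\<close> appears in position \<open>Suc k\<close> as the value of proposition
  \<open>idx k\<close>. Dummy bits are read as \<open>False\<close>, in agreement with
  \<open>obeys\<close>.\<close>

definition game_strategy :: "(bool list \<Rightarrow> bool) \<Rightarrow> 'a val list \<Rightarrow> 'a val" where
  "game_strategy s h = (let m = length h - 1 in
     if idx m < n then (last h)(qvar (idx m) \<mapsto>
       s (map (\<lambda>k. idx k < n \<and> (h ! Suc k) (qvar (idx k)) = Some True) [0..<m]))
     else Map.empty)"

abbreviation "G \<psi> \<equiv> qgame qs (ltl_lang (set (map snd qs)) \<psi>)"

lemma card_props: "i \<le> n \<Longrightarrow> card (props i) = i"
  using distinct distinct_card[of "take i (map snd qs)"] by (simp add: min_def)

lemma props_inject: "i \<le> n \<Longrightarrow> j \<le> n \<Longrightarrow> props i = props j \<longleftrightarrow> i = j"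
  using card_props by metis

lemma idx_le: "idx m \<le> n"
  using mod_less_divisor[of "Suc n" m] by linarith

lemma moves_G: "(v, v') \<in> moves (G \<psi>) \<longleftrightarrow>
    (\<exists>m<n. dom v = props m \<and> dom v' = props (Suc m) \<and> v \<subseteq>\<^sub>m v') \<or> (dom v = props n \<and> v' = Map.empty)"
  by (simp add: qgame_def Let_def)

text \<open>The propositions are distinct, so the domain of a position determines its place in the
  round.\<close>

lemma dom_move:
  assumes "(v, v') \<in> moves (G \<psi>)" "dom v = props (idx k)"
  shows "dom v' = props (idx (Suc k)) \<and> (idx k < n \<longrightarrow> v \<subseteq>\<^sub>m v')"
proof (cases "idx k < n")
  case True
  then have "\<exists>m<n. props (idx k) = props m \<and> dom v' = props (Suc m) \<and> v \<subseteq>\<^sub>m v'"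
    using assms props_inject[of "idx k" n] unfolding moves_G by auto
  then obtain m where "m < n" "props (idx k) = props m" "dom v' = props (Suc m)" "v \<subseteq>\<^sub>m v'" by blast
  then show ?thesis using props_inject[of "idx k" m] True by (simp add: mod_Suc)
next
  case False
  then have k: "idx k = n" using idx_le[of k] by simp
  then have "\<not> (\<exists>m<n. dom v = props m)" using assms(2) props_inject[of n] by (metis less_imp_le nat_neq_iff order_refl)
  then have "v' = Map.empty" using assms(1) unfolding moves_G by blast
  then show ?thesis using k by (simp add: mod_Suc)
qed

lemma history_dom:
  assumes h: "is_history (G \<psi>) h" and "k < length h"
  shows "dom (h ! k) = props (idx k)"
  using assms(2)
proof (induction k)
  case 0
  then show ?case using h by (simp add: is_history_def hd_conv_nth[symmetric]) (simp add: qgame_def Let_def)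
next
  case (Suc k)
  then have "(h ! k, h ! Suc k) \<in> moves (G \<psi>)" using h by (simp add: is_history_def)
  then show ?case using dom_move Suc by simp
qed

lemma positions_G:
  assumes "dom v = props (idx m)"
  shows "v \<in> posE (G \<psi>) \<longleftrightarrow> owns QEx m" "v \<in> posE (G \<psi>) \<union> posA (G \<psi>)"
proof -
  show "v \<in> posE (G \<psi>) \<longleftrightarrow> owns QEx m"
  proof -
    have "props (idx m) = props j \<longleftrightarrow> idx m = j" if "j < n" for j
      using that idx_le[of m] by (intro props_inject) simp_all
    then have "(\<exists>j<n. props (idx m) = props j \<and> fst (qs ! j) = QEx) \<longleftrightarrow> owns QEx m"
      unfolding owns_def by blast
    then show ?thesis using assms by (simp add: qgame_def Let_def)
  qed
  show "v \<in> posE (G \<psi>) \<union> posA (G \<psi>)"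
  proof -
    have "\<exists>j\<le>n. props (idx m) = props j" using idx_le[of m] by blast
    then show ?thesis using assms by (auto simp: qgame_def Let_def)
  qed
qed

lemma history_last:
  assumes "is_history (G \<psi>) h"
  shows "dom (last h) = props (idx (length h - 1))"
  using history_dom[OF assms, of "length h - 1"] assms by (simp add: is_history_def last_conv_nth)

lemma game_strategy_move:
  assumes "is_history (G \<psi>) h"
  shows "(last h, game_strategy s h) \<in> moves (G \<psi>)"
proof (cases "idx (length h - 1) < n")
  case True
  define m where "m = idx (length h - 1)"
  obtain c where c: "game_strategy s h = (last h)(qvar m \<mapsto> c)"
    using True by (simp add: game_strategy_def Let_def m_def)
  have d: "dom (last h) = props m" using history_last[OF assms] by (simp add: m_def)
  have "m < n" using True by (simp add: m_def)
  moreover have "dom (game_strategy s h) = props (Suc m)"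
    using d \<open>m < n\<close> by (simp add: c props_Suc)
  moreover have "qvar m \<notin> dom (last h)"
    unfolding d using \<open>m < n\<close> qvar_inject by (auto simp: in_props)
  then have "last h \<subseteq>\<^sub>m game_strategy s h" by (auto simp: c map_le_def)
  ultimately show ?thesis unfolding moves_G using d by blast
next
  case False
  then have "idx (length h - 1) = n" using idx_le by (metis le_neq_implies_less)
  then show ?thesis
    using history_last[OF assms] False unfolding moves_G by (simp add: game_strategy_def Let_def)
qed

lemma play_outcome:
  assumes sE: "is_strategy (G \<psi>) (posE (G \<psi>)) sE" and sA: "is_strategy (G \<psi>) (posA (G \<psi>)) sA"
    and hero: "(if Q = QEx then sE else sA) = game_strategy s"
  shows "\<exists>b. obeys Q s b \<and> (obs_winning (G \<psi>) (play (G \<psi>) sE sA) \<longleftrightarrow> ltl_holds (letters b) 0 \<psi>)"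
proof -
  define \<rho> where "\<rho> = play (G \<psi>) sE sA"
  have pos: "last h \<in> posE (G \<psi>) \<union> posA (G \<psi>)" if "is_history (G \<psi>) h" for h
    using positions_G(2)[OF history_last[OF that]] .
  have hist: "is_history (G \<psi>) (pre \<rho> (Suc k))" for k
    using is_history_play[OF sE sA pos, of k] by (simp add: play_hist_eq \<rho>_def del: upt_Suc)
  have dom\<rho>: "dom (\<rho> k) = props (idx k)" for k
    using history_dom[OF hist[of k], of k] by (simp del: upt_Suc)
  have move: "(\<rho> k, \<rho> (Suc k)) \<in> moves (G \<psi>)" for k
    using hist[of "Suc k"] unfolding is_history_def
    by (auto dest!: spec[of _ k] simp del: upt_Suc)
  have \<rho>_Suc: "\<rho> (Suc k) = (if \<rho> k \<in> posE (G \<psi>) then sE (pre \<rho> (Suc k)) else sA (pre \<rho> (Suc k)))" for k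
  proof -
    have "\<rho> (Suc k) = last (play_hist (G \<psi>) sE sA (Suc k))" by (simp add: \<rho>_def play_def)
    also have "\<dots> = (if \<rho> k \<in> posE (G \<psi>) then sE (pre \<rho> (Suc k)) else sA (pre \<rho> (Suc k)))"
      by (simp only: play_hist.simps(2)) (simp add: play_hist_eq Let_def \<rho>_def last_map del: upt_Suc)
    finally show ?thesis .
  qed
  define b where "b k \<longleftrightarrow> idx k < n \<and> \<rho> (Suc k) (qvar (idx k)) = Some True" for k
  have "obeys Q s b"
    unfolding obeys_def
  proof (intro conjI allI impI)
    show "\<not> b m" if "idx m = n" for m using that by (simp add: b_def)
  next
    fix m assume own: "owns Q m"
    then have m: "idx m < n" by (simp add: owns_def)
    have "\<rho> m \<in> posE (G \<psi>) \<longleftrightarrow> Q = QEx"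
      unfolding positions_G(1)[OF dom\<rho>] using own by (auto simp: owns_def)
    then have "\<rho> (Suc m) = game_strategy s (pre \<rho> (Suc m))"
      using hero by (auto simp: \<rho>_Suc split: if_splits simp del: upt_Suc)
    also have "\<dots> = (\<rho> m)(qvar (idx m) \<mapsto> s (pre b m))"
    proof -
      have "map (\<lambda>k. idx k < n \<and> (pre \<rho> (Suc m) ! Suc k) (qvar (idx k)) = Some True) [0..<m] = pre b m"
        by (simp add: b_def del: upt_Suc)
      then show ?thesis using m unfolding game_strategy_def Let_def by (simp add: last_map del: upt_Suc map_eq_conv)
    qed
    finally show "b m = s (pre b m)" using m by (simp add: b_def)
  qed
  \<comment> \<open>Within a round positions only grow, so each retains all bits chosen since the
    round began.\<close>
  moreover have val: "j < idx k \<Longrightarrow> \<rho> k (qvar j) = Some (b (k div Suc n * Suc n + j))" for j k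
  proof (induction k)
    case (Suc k)
    have k: "idx k < n"
    proof (rule ccontr)
      assume "\<not> idx k < n"
      then have "idx k = n" using idx_le[of k] by simp
      with Suc.prems show False by (simp add: mod_Suc)
    qed
    have Sk: "idx (Suc k) = Suc (idx k)" "Suc k div Suc n = k div Suc n"
      using k by (simp_all add: mod_Suc div_Suc)
    have le: "\<rho> k \<subseteq>\<^sub>m \<rho> (Suc k)" using dom_move[OF move dom\<rho>] k by blast
    show ?case
    proof (cases "j < idx k")
      case True
      then show ?thesis using Suc.IH le Sk unfolding map_le_def by (metis domI)
    next
      case False
      then have j: "j = idx k" using Suc.prems Sk by simp
      have "qvar j \<in> dom (\<rho> (Suc k))"
        unfolding dom\<rho> using Suc.prems k j by (auto simp: in_props Sk)
      then obtain c where "\<rho> (Suc k) (qvar j) = Some c" by auto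
      moreover have "k div Suc n * Suc n + j = k" using j pos_collapse by blast
      ultimately show ?thesis using k j Sk by (auto simp: b_def)
    qed
  qed simp
  moreover have "obs_winning (G \<psi>) \<rho> \<longleftrightarrow> ltl_holds (letters b) 0 \<psi>"
  proof -
    \<comment> \<open>Round \<open>k\<close> ends at position \<open>f k\<close>; exactly these
      positions are total valuations.\<close>
    define f where "f k = k * Suc n + n" for k
    have "strict_mono f" by (simp add: f_def strict_mono_def less_imp_le add_less_le_mono)
    have I: "{i. \<rho> i \<in> observable (G \<psi>)} = range f"
    proof -
      have "\<rho> i \<in> observable (G \<psi>) \<longleftrightarrow> idx i = n" for i
        using dom\<rho>[of i] props_inject[OF idx_le order_refl, of i] by (simp add: qgame_def Let_def)
      moreover have "idx i = n \<longleftrightarrow> i \<in> range f" for i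
      proof
        assume "idx i = n"
        then have "i = f (i div Suc n)" using pos_collapse[of i] by (simp add: f_def)
        then show "i \<in> range f" by (rule range_eqI)
      next
        assume "i \<in> range f"
        then show "idx i = n" using pos_mod[of n] by (auto simp: f_def)
      qed
      ultimately show ?thesis by blast
    qed
    have "infinite (range f)" using \<open>strict_mono f\<close> by (simp add: range_inj_infinite strict_mono_imp_inj_on)
    then have "observation (G \<psi>) \<rho> = Some (\<lambda>k. \<rho> (f k))"
      unfolding observation_def Let_def I by (simp add: enumerate_strict_mono_range[OF \<open>strict_mono f\<close>])
    also have "(\<lambda>k. \<rho> (f k)) = word (asg_of b n)"
    proof (intro ext)
      fix k p
      have fk: "idx (f k) = n" "f k div Suc n = k"
        using pos_mod[of n k] pos_div[of n k] by (simp_all add: f_def)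
      show "\<rho> (f k) p = word (asg_of b n) k p"
      proof (cases "p \<in> props n")
        case True
        then obtain j where j: "j < n" "p = qvar j" unfolding in_props by blast
        then have "\<rho> (f k) p = Some (letters b k p)" using val[of j "f k"] fk by (simp add: letters_qvar)
        then show ?thesis using True by (simp add: word_def asg_of_def)
      next
        case False
        then have "\<rho> (f k) p = None" using dom\<rho>[of "f k"] fk by (metis domIff)
        then show ?thesis using False by (simp add: word_def asg_of_def)
      qed
    qed
    finally have "obs_winning (G \<psi>) \<rho> \<longleftrightarrow> word (asg_of b n) \<in> word ` ltl_lang (set (map snd qs)) \<psi>"
      unfolding obs_winning_def by (simp add: qgame_def Let_def)
    also have "\<dots> \<longleftrightarrow> asg_of b n \<in> ltl_lang (set (map snd qs)) \<psi>"
      using word_inject by blast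
    also have "\<dots> \<longleftrightarrow> ltl_models (asg_of b n) \<psi>"
      using asg_of_Asg[of b n] by (simp add: ltl_lang_def)
    also have "asg_letters (asg_of b n) = letters b"
      by (auto simp: fun_eq_iff asg_letters_def asg_of_def letters_def)
    then have "ltl_models (asg_of b n) \<psi> \<longleftrightarrow> ltl_holds (letters b) 0 \<psi>" by (simp add: ltl_models_def)
    finally show ?thesis .
  qed
  ultimately show ?thesis unfolding \<rho>_def by blast
qed

lemma strategy_wins_game:
  assumes wins: "\<And>b. obeys Q s b \<Longrightarrow> ltl_holds (letters b) 0 \<psi> \<longleftrightarrow> Q = QEx"
  shows "if Q = QEx then eloise_wins (G \<psi>) else abelard_wins (G \<psi>)"
proof -
  have s: "is_strategy (G \<psi>) P (game_strategy s)" for P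
    using game_strategy_move by (simp add: is_strategy_def)
  show ?thesis
  proof (cases "Q = QEx")
    case True
    then show ?thesis
      using s play_outcome[of \<psi> "game_strategy s" _ Q s] wins unfolding eloise_wins_def by (metis (full_types))
  next
    case False
    then show ?thesis
      using s play_outcome[of \<psi> _ "game_strategy s" Q s] wins unfolding abelard_wins_def by (metis (full_types))
  qed
qed

section \<open>Determinacy applied to the quantification game\<close>

lemma open_letters: "open_pred (\<lambda>b. letters b i p = c)"
  unfolding open_pred_def
proof (intro allI impI exI)
  fix b b' assume b: "letters b i p = c" "pre b' (Suc i * Suc n) = pre b (Suc i * Suc n)"
  have "b' (i * Suc n + j) = b (i * Suc n + j)" if "j < n" for j
  proof -
    have "i * Suc n + j < Suc i * Suc n" using that by simp
    then show ?thesis using b(2) by (simp add: map_eq_conv del: mult_Suc mult_Suc_right)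
  qed
  then have "letters b' i p = letters b i p" unfolding letters_def by metis
  then show "letters b' i p = c" using b(1) by simp
qed

theorem strategy_exists: "\<exists>Q s. \<forall>b. obeys Q s b \<longrightarrow> (ltl_holds (letters b) 0 \<psi> \<longleftrightarrow> Q = QEx)"
proof -
  interpret sequence_game "owns QEx" .
  obtain D where D: "\<And>b. ltl_holds (letters b) 0 \<psi> \<longleftrightarrow> (\<exists>n::nat. infinite {k. pre b k \<in> D n})"
    by (rule ltl_sigma3[where w = letters and \<psi> = \<psi>, OF open_letters]) blast
  \<comment> \<open>Dummy bits are forced to be \<open>False\<close>. Dummy moves are not owned by
    \<open>QEx\<close>, so \<open>quasi\<close> asks for only one successor there.\<close>
  define T where "T = {r :: bool list. \<forall>k<length r. idx k = n \<longrightarrow> \<not> r ! k}"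
  have T_app: "r @ [a] \<in> T \<longleftrightarrow> r \<in> T \<and> (idx (length r) = n \<longrightarrow> \<not> a)" for r a
    by (auto simp: T_def nth_append less_Suc_eq)
  have qT: "quasi T" unfolding quasi_def T_app by (auto simp: owns_def)
  have eT: "[] \<in> T" by (simp add: T_def)
  have pT: "pre b k \<in> T" if "obeys Q s b" for Q s b k
    using that by (auto simp: T_def obeys_def)
  show ?thesis
  proof (rule sigma3_determinacy[OF qT eT D])
    fix s assume "\<And>b. (\<And>k. pre b k \<in> T) \<Longrightarrow> (\<And>k. owns QEx k \<Longrightarrow> b k = s (pre b k)) \<Longrightarrow> ltl_holds (letters b) 0 \<psi>"
    then have "\<forall>b. obeys QEx s b \<longrightarrow> ltl_holds (letters b) 0 \<psi>" using pT unfolding obeys_def by blast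
    then show ?thesis by blast
  next
    fix s assume s: "\<And>b. (\<And>k. pre b k \<in> T) \<Longrightarrow>
      (\<And>k. \<not> owns QEx k \<Longrightarrow> b k = s (pre b k) \<or> (\<forall>a. pre b k @ [a] \<in> T \<longrightarrow> a = b k)) \<Longrightarrow>
      \<not> ltl_holds (letters b) 0 \<psi>"
    have "\<not> ltl_holds (letters b) 0 \<psi>" if b: "obeys QAll s b" for b
    proof (rule s)
      show "pre b k \<in> T" for k using b by (rule pT)
      fix k assume k: "\<not> owns QEx k"
      show "b k = s (pre b k) \<or> (\<forall>a. pre b k @ [a] \<in> T \<longrightarrow> a = b k)"
      proof (cases "idx k = n")
        case True
        \<comment> \<open>At a dummy index \<open>T\<close> leaves a single move, so
          \<open>s\<close> need not predict it.\<close>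
        then show ?thesis using b by (simp add: T_app obeys_def)
      next
        case False
        then have "idx k < n" using idx_le by (metis le_neq_implies_less)
        then have "owns QAll k" using k by (cases "fst (qs ! idx k)") (auto simp: owns_def)
        then show ?thesis using b by (simp add: obeys_def)
      qed
    qed
    then show ?thesis by blast
  qed
qed

end

text \<open>The play of the two winning strategies against each other would be both won and
  lost.\<close>

lemma not_both_win: "\<not> (eloise_wins G \<and> abelard_wins G)"
  unfolding eloise_wins_def abelard_wins_def by blast

theorem mainTheorem16:
  fixes qs :: "(quant \<times> 'a) list" and \<psi> :: "'a ltl"
  assumes "distinct (map snd qs)"
    and "ltl_props \<psi> \<subseteq> set (map snd qs)"
  shows "(satisfiable (behav_formula qs \<psi>) \<longleftrightarrow>
            eloise_wins (qgame qs (ltl_lang (set (map snd qs)) \<psi>)))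
       \<and> (\<not> satisfiable (behav_formula qs \<psi>) \<longleftrightarrow>
            abelard_wins (qgame qs (ltl_lang (set (map snd qs)) \<psi>)))"
proof -
  interpret quantifier_prefix qs by unfold_locales (rule assms(1))
  obtain Q s where s: "\<And>b. obeys Q s b \<Longrightarrow> ltl_holds (letters b) 0 \<psi> \<longleftrightarrow> Q = QEx"
    using strategy_exists by metis
  show ?thesis
    using strategy_satisfiable[OF s assms(2)] strategy_wins_game[OF s] not_both_win
    by (cases "Q = QEx") auto
qed

end
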